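(* Let $n\ge3$ and let $N\subset\mathbb{R}^m$ be a fixed connected closed Riemannian manifold isometrically embedded in $\mathbb{R}^m$. Let $u_i:\mathbb{R}^n\times\mathbb{R}_+\rightarrow N\subset \mathbb{R}^m$, $i=1,2$, be two solutions of the harmonic map flow coming out of the same $0$-homogeneous map $u_0:\mathbb{R}^n\setminus\{0\}\to N$. Assume $u_1$ and $u_2$ are regular at infinity. Let $c_0$ be a positive constant such that $$\sup_{\mathbb{R}^n\times\mathbb{R}_+}(|x|^2+t)|\nabla u_i|^2\leq c_0,\quad i=1,2.$$ Then $$|u_1-u_2|(x,t)\leq C f^{-\frac{n}{2}}(x,t)\,e^{-f(x,t)},\quad (x,t)\in \Omega_{\lambda},$$ for some $\lambda\geq \lambda(n,c_0)>0$ and some positive constant $C=C(n,c_0)$ (where $\lambda(n,c_0)$ and $C(n,c_0)$ depend, for the fixed target $N\subset\mathbb{R}^m$, only on $n$ and $c_0$).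
   Context: Harmonic map flow: maps $u:\mathbb{R}^n\times\mathbb{R}_+\to N\subset\mathbb{R}^m$, smooth for $t>0$, with $\partial_t u=\Delta u+A(u)(\nabla u,\nabla u)$, where $A(u)(\cdot,\cdot):T_uN\times T_uN\to(T_uN)^\perp$ is the second fundamental form of $N\subset\mathbb{R}^m$ (with the sign convention making the equation equivalent to $\partial_tu-\Delta u\perp T_uN$) and $A(u)(\nabla u,\nabla u)=\sum_i A(u)(\partial_iu,\partial_iu)$. A map $u_0$ is $0$-homogeneous if $u_0(\lambda x)=u_0(x)$ for all $\lambda>0$. A solution $u$ comes out of $u_0$ if $\lim_{t\to0}u(x,t)=u_0(x)$ for every $x\neq0$. $f(x,t)=\frac{|x|^2}{4t}+\frac n2$ and, for $\lambda\ge0$, $\Omega_\lambda=\{(x,t): t>0,\ |x|^2/(4t)>\lambda\}$. A smooth solution $u$ coming out of a $0$-homogeneous map is regular at infinity if there is $\lambda\in\mathbb{R}_+$ such that for each positive integer $k$ there is a constant $C_k>0$ with $|\nabla^ku|(x,t)\le C_k(|x|^2+t)^{-k/2}$ for all $(x,t)\in\Omega_\lambda$. *)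

theory Defs
  imports "HOL-Analysis.Analysis"
begin

section \<open>Smooth maps\<close>

text \<open>Both notions below are meant for an open set \<open>S\<close>: \<open>f\<close> is \<open>k\<close> times continuously
  differentiable, respectively smooth, on \<open>S\<close>.\<close>

fun C_k_on :: "nat \<Rightarrow> 'a::euclidean_space set \<Rightarrow> ('a \<Rightarrow> 'b::real_normed_vector) \<Rightarrow> bool" where
  "C_k_on 0 S f \<longleftrightarrow> continuous_on S f"
| "C_k_on (Suc k) S f \<longleftrightarrow>
     (\<forall>x\<in>S. f differentiable (at x)) \<and>
     (\<forall>v. C_k_on k S (\<lambda>x. frechet_derivative f (at x) v))"

definition smooth_on :: "'a::euclidean_space set \<Rightarrow> ('a \<Rightarrow> 'b::real_normed_vector) \<Rightarrow> bool" where
  "smooth_on S f \<longleftrightarrow> (\<forall>k. C_k_on k S f)"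

section \<open>Closed submanifolds of Euclidean space and their second fundamental form\<close>

text \<open>An embedded smooth \<open>d\<close>-dimensional submanifold without boundary, by slice charts.\<close>

definition submanifold :: "nat \<Rightarrow> 'b::euclidean_space set \<Rightarrow> bool" where
  "submanifold d N \<longleftrightarrow>
     (\<forall>p\<in>N. \<exists>U V \<phi> \<psi> L.
        open U \<and> p \<in> U \<and> open (V :: 'b set) \<and>
        homeomorphism U V \<phi> \<psi> \<and> smooth_on U \<phi> \<and> smooth_on V \<psi> \<and>
        subspace L \<and> dim L = d \<and> \<phi> ` (N \<inter> U) = L \<inter> V)"

definition connected_closed_manifold :: "'b::euclidean_space set \<Rightarrow> bool" where
  "connected_closed_manifold N \<longleftrightarrow> compact N \<and> connected N \<and> (\<exists>d. submanifold d N)"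

text \<open>Velocities at \<open>p\<close> of smooth curves in \<open>N\<close>.\<close>

definition tangent_space :: "'b::euclidean_space set \<Rightarrow> 'b \<Rightarrow> 'b set" where
  "tangent_space N p =
     {v. \<exists>\<gamma> e. 0 < e \<and> smooth_on {-e<..<e} \<gamma> \<and> \<gamma> ` {-e<..<e} \<subseteq> N \<and> \<gamma> 0 = p \<and>
           (\<gamma> has_vector_derivative v) (at (0::real))}"

text \<open>For \<open>v, w\<close> tangent at \<open>p\<close>, the value is minus the normal component of the derivative at
  \<open>p\<close>, in the direction \<open>v\<close>, of any tangent field \<open>W\<close> (extended smoothly to an open set of the
  ambient space) with \<open>W p = w\<close>; the normal component of that derivative does not depend on \<open>W\<close>.
  The condition that the derivative plus \<open>a\<close> is tangent, with \<open>a\<close> normal, says that \<open>a\<close> is minus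
  this normal component. The minus sign is the convention for which
  \<open>\<Delta>u + A(u)(\<nabla>u,\<nabla>u)\<close> is the tangential part of \<open>\<Delta>u\<close>; on the unit sphere,
  \<open>A(p)(v,w) = (v \<bullet> w) p\<close>.\<close>

definition second_fundamental_form :: "'b::euclidean_space set \<Rightarrow> 'b \<Rightarrow> 'b \<Rightarrow> 'b \<Rightarrow> 'b" where
  "second_fundamental_form N p v w =
     (THE a. \<exists>U W. open U \<and> p \<in> U \<and> smooth_on U W \<and>
        (\<forall>q \<in> N \<inter> U. W q \<in> tangent_space N q) \<and> W p = w \<and>
        a \<in> (tangent_space N p)\<^sup>\<bottom> \<and>
        frechet_derivative W (at p) v + a \<in> tangent_space N p)"

section \<open>Spatial derivatives\<close>

definition partial_deriv :: "'n::finite \<Rightarrow> (real^'n \<Rightarrow> 'b::real_normed_vector) \<Rightarrow> real^'n \<Rightarrow> 'b" where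
  "partial_deriv i g x = frechet_derivative g (at x) (axis i 1)"

text \<open>\<open>|\<nabla>\<^sup>k g|(x)\<close> is the Euclidean (Hilbert-Schmidt) norm of the tensor of all iterated partial
  derivatives of order \<open>k\<close>, indexed by the lists of length \<open>k\<close>.\<close>

definition norm_nabla :: "nat \<Rightarrow> (real^'n::finite \<Rightarrow> 'b::real_normed_vector) \<Rightarrow> real^'n \<Rightarrow> real" where
  "norm_nabla k g x = sqrt (\<Sum>is | length is = k. (norm (foldr partial_deriv is g x))\<^sup>2)"

definition laplacian :: "(real^'n::finite \<Rightarrow> 'b::real_normed_vector) \<Rightarrow> real^'n \<Rightarrow> 'b" where
  "laplacian g x = (\<Sum>i\<in>UNIV. partial_deriv i (partial_deriv i g) x)"

section \<open>The harmonic map flow\<close>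

text \<open>Maps are total on space-time \<open>real^'n \<times> real\<close>; only their values at positive times matter.\<close>

definition harmonic_map_flow ::
    "(real^'m::finite) set \<Rightarrow> ((real^'n::finite) \<times> real \<Rightarrow> real^'m) \<Rightarrow> bool" where
  "harmonic_map_flow N u \<longleftrightarrow>
     u ` (UNIV \<times> {0<..}) \<subseteq> N \<and>
     smooth_on (UNIV \<times> {0<..}) u \<and>
     (\<forall>x. \<forall>t>0.
        vector_derivative (\<lambda>s. u (x, s)) (at t) =
          laplacian (\<lambda>y. u (y, t)) x +
          (\<Sum>i\<in>UNIV. second_fundamental_form N (u (x, t))
             (partial_deriv i (\<lambda>y. u (y, t)) x)
             (partial_deriv i (\<lambda>y. u (y, t)) x)))"

text \<open>A \<open>0\<close>-homogeneous map from the complement of the origin to \<open>N\<close>; its value at \<open>0\<close> is irrelevant.\<close>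

definition zero_homogeneous :: "'b set \<Rightarrow> (real^'n::finite \<Rightarrow> 'b) \<Rightarrow> bool" where
  "zero_homogeneous N u0 \<longleftrightarrow>
     (\<forall>x. x \<noteq> 0 \<longrightarrow> u0 x \<in> N) \<and>
     (\<forall>x l. x \<noteq> 0 \<and> l > 0 \<longrightarrow> u0 (l *\<^sub>R x) = u0 x)"

definition comes_out_of ::
    "((real^'n::finite) \<times> real \<Rightarrow> 'b::topological_space) \<Rightarrow> (real^'n \<Rightarrow> 'b) \<Rightarrow> bool" where
  "comes_out_of u u0 \<longleftrightarrow> (\<forall>x. x \<noteq> 0 \<longrightarrow> ((\<lambda>t. u (x, t)) \<longlongrightarrow> u0 x) (at_right 0))"

definition weight_f :: "(real^'n::finite) \<times> real \<Rightarrow> real" where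
  "weight_f = (\<lambda>(x, t). (norm x)\<^sup>2 / (4 * t) + real CARD('n) / 2)"

definition Omega :: "real \<Rightarrow> ((real^'n::finite) \<times> real) set" where
  "Omega l = {(x, t). 0 < t \<and> (norm x)\<^sup>2 / (4 * t) > l}"

definition regular_at_infinity ::
    "((real^'n::finite) \<times> real \<Rightarrow> 'b::real_normed_vector) \<Rightarrow> bool" where
  "regular_at_infinity u \<longleftrightarrow>
     (\<exists>l\<ge>0. \<forall>k\<ge>1. \<exists>C>0. \<forall>(x, t) \<in> Omega l.
        norm_nabla k (\<lambda>y. u (y, t)) x \<le> C * ((norm x)\<^sup>2 + t) powr (- real k / 2))"

text \<open>\<open>sup (|x|\<^sup>2 + t) |\<nabla>u|\<^sup>2 \<le> c\<close>, stated pointwise since the supremum of an unbounded set of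
  reals is unspecified.\<close>

definition scaled_gradient_bound ::
    "((real^'n::finite) \<times> real \<Rightarrow> 'b::real_normed_vector) \<Rightarrow> real \<Rightarrow> bool" where
  "scaled_gradient_bound u c \<longleftrightarrow>
     (\<forall>x. \<forall>t>0. ((norm x)\<^sup>2 + t) * (norm_nabla 1 (\<lambda>y. u (y, t)) x)\<^sup>2 \<le> c)"

end

theory Submission
  imports Defs
begin

text \<open>Put \<open>w = u1 - u2\<close>. The tension \<open>\<nu> = \<partial>\<^sub>t u - \<Delta>u\<close> is normal to \<open>N\<close>, and a chord of
  the compact submanifold \<open>N\<close> is tangential up to second order:
  \<open>|(q - p) \<bullet> \<nu>| \<le> C |\<nu>| |q - p|\<^sup>2\<close> for \<open>\<nu>\<close> normal at \<open>p\<close>. Applied to nearby points of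
  one solution this gives \<open>|\<nu>| \<le> 2C |\<nabla>u|\<^sup>2\<close>; applied to \<open>u1\<close> and \<open>u2\<close> it gives
  \<open>(\<partial>\<^sub>t w - \<Delta>w) \<bullet> w \<le> K |w|\<^sup>2 / |x|\<^sup>2\<close> with \<open>K = 4 C\<^sup>2 c0\<close>, without any gradient of \<open>w\<close>.
  For \<open>s = |x|\<^sup>2 / (4t)\<close> the function \<open>s\<^bsup>-n/2\<^esup> e\<^bsup>-s\<^esup> (1 - a/s)\<close> with \<open>a = n/2 + K/4\<close> is a
  supersolution of the corresponding linear equation, and a large multiple of it dominates \<open>|w|\<close> on
  the parabola \<open>s = \<lambda>\<close> because \<open>N\<close> is bounded. Adding \<open>\<epsilon>\<close> times a supersolution that
  blows up at the origin and at infinity makes the comparison take place on a compact set away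
  from \<open>t = 0\<close>, where \<open>w\<close> tends to \<open>0\<close> locally uniformly by the gradient bound; then \<open>\<epsilon> \<rightarrow> 0\<close>.\<close>

section \<open>Differential calculus of smooth maps\<close>

lemma C_k_on_Suc_D:
  assumes "C_k_on (Suc k) S f"
  shows "C_k_on k S f"
  using assms
proof (induction k arbitrary: f)
  case 0
  then show ?case
    by (auto intro!: differentiable_imp_continuous_on differentiable_at_imp_differentiable_on)
next
  case (Suc k)
  then show ?case by simp
qed

lemma C_k_on_imp_continuous_on: "C_k_on k S f \<Longrightarrow> continuous_on S f"
  by (induction k) (auto dest: C_k_on_Suc_D simp del: C_k_on.simps(2))

lemma frechet_derivative_cong_open:
  assumes "open S" "x \<in> S" "\<And>y. y \<in> S \<Longrightarrow> f y = g y"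
  shows "frechet_derivative f (at x) = frechet_derivative g (at x)"
proof -
  have "(f has_derivative D) (at x) \<longleftrightarrow> (g has_derivative D) (at x)" for D
    using assms has_derivative_transform_within_open by metis
  then show ?thesis by (simp add: frechet_derivative_def)
qed

lemma C_k_on_cong:
  assumes "open S" "\<And>x. x \<in> S \<Longrightarrow> f x = g x" "C_k_on k S f"
  shows "C_k_on k S g"
  using assms(2,3)
proof (induction k arbitrary: f g)
  case 0
  then show ?case by (simp cong: continuous_on_cong_simp)
next
  case (Suc k)
  have "g differentiable at x" if "x \<in> S" for x
    using Suc.prems that assms(1)
    by (metis C_k_on.simps(2) differentiable_def has_derivative_transform_within_open)
  moreover have "C_k_on k S (\<lambda>x. frechet_derivative g (at x) v)" for v
  proof (rule Suc.IH)
    show "C_k_on k S (\<lambda>x. frechet_derivative f (at x) v)" using Suc.prems by simp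
  qed (simp add: frechet_derivative_cong_open[OF assms(1) _ Suc.prems(1)])
  ultimately show ?case by simp
qed

lemma C_k_on_SucI:
  assumes "open S" "\<And>x. x \<in> S \<Longrightarrow> (f has_derivative D x) (at x)"
    and "\<And>v. C_k_on k S (\<lambda>x. D x v)"
  shows "C_k_on (Suc k) S f"
  unfolding C_k_on.simps(2)
proof (intro conjI ballI allI)
  show "f differentiable at x" if "x \<in> S" for x
    using assms(2) that by (auto simp: differentiable_def)
  show "C_k_on k S (\<lambda>x. frechet_derivative f (at x) v)" for v
    using assms(2) by (intro C_k_on_cong[OF assms(1) _ assms(3)[of v]])
      (metis frechet_derivative_at)
qed

lemma C_k_on_has_derivative:
  assumes "C_k_on (Suc k) S f" "x \<in> S"
  shows "(f has_derivative frechet_derivative f (at x)) (at x)"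
  using assms frechet_derivative_works by auto

lemma C_k_on_frechet: "C_k_on (Suc k) S f \<Longrightarrow> C_k_on k S (\<lambda>x. frechet_derivative f (at x) v)"
  by simp

lemma C_k_on_const: "open S \<Longrightarrow> C_k_on k S (\<lambda>x. c)"
proof (induction k arbitrary: c)
  case (Suc k)
  then show ?case by (intro C_k_on_SucI[where D = "\<lambda>_ _. 0"]) auto
qed simp

lemma C_k_on_bounded_linear:
  assumes "open S" "bounded_linear L" "C_k_on k S f"
  shows "C_k_on k S (\<lambda>x. L (f x))"
  using assms(3)
proof (induction k arbitrary: f)
  case 0
  then show ?case using assms(2) by (simp add: bounded_linear.continuous_on)
next
  case (Suc k)
  show ?case
    by (rule C_k_on_SucI[OF assms(1) bounded_linear.has_derivative[OF assms(2) C_k_on_has_derivative]])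
      (use Suc in \<open>auto simp del: C_k_on.simps intro!: Suc.IH C_k_on_frechet\<close>)
qed

lemma C_k_on_add:
  assumes "open S" "C_k_on k S f" "C_k_on k S g"
  shows "C_k_on k S (\<lambda>x. f x + g x)"
  using assms(2,3)
proof (induction k arbitrary: f g)
  case 0
  then show ?case by (simp add: continuous_on_add)
next
  case (Suc k)
  show ?case
    by (rule C_k_on_SucI[OF assms(1) has_derivative_add[OF C_k_on_has_derivative C_k_on_has_derivative]])
      (use Suc in \<open>auto simp del: C_k_on.simps intro!: Suc.IH C_k_on_frechet\<close>)
qed

lemma C_k_on_sum:
  assumes "open S" "finite I" "\<And>i. i \<in> I \<Longrightarrow> C_k_on k S (f i)"
  shows "C_k_on k S (\<lambda>x. \<Sum>i\<in>I. f i x)"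
  using assms(2,3) by (induction I rule: finite_induct) (auto intro: C_k_on_const C_k_on_add assms(1))

lemma C_k_on_scaleR:
  fixes f :: "'a::euclidean_space \<Rightarrow> real"
  assumes "open S" "C_k_on k S f" "C_k_on k S g"
  shows "C_k_on k S (\<lambda>x. f x *\<^sub>R g x)"
  using assms(2,3)
proof (induction k arbitrary: f g)
  case 0
  then show ?case by (simp add: continuous_on_scaleR)
next
  case (Suc k)
  have "C_k_on k S f" "C_k_on k S g"
    using Suc.prems by (auto intro!: C_k_on_Suc_D simp del: C_k_on.simps)
  then show ?case
    by (intro C_k_on_SucI[OF assms(1) has_derivative_scaleR[OF C_k_on_has_derivative C_k_on_has_derivative]])
      (use Suc.prems in \<open>auto simp del: C_k_on.simps
         intro!: C_k_on_add[OF assms(1)] Suc.IH C_k_on_frechet\<close>)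
qed

lemma linear_basis_expansion:
  fixes v :: "'a::euclidean_space"
  assumes "linear L"
  shows "L v = (\<Sum>b\<in>Basis. (v \<bullet> b) *\<^sub>R L b)"
proof -
  have "L v = L (\<Sum>b\<in>Basis. (v \<bullet> b) *\<^sub>R b)" by (simp add: euclidean_representation)
  also have "\<dots> = (\<Sum>b\<in>Basis. (v \<bullet> b) *\<^sub>R L b)"
    by (simp only: linear_sum[OF assms] linear_cmul[OF assms])
  finally show ?thesis .
qed

lemma C_k_on_compose:
  fixes f :: "'a::euclidean_space \<Rightarrow> 'b::euclidean_space" and g :: "'b \<Rightarrow> 'c::real_normed_vector"
  assumes "open S" "open T" "f ` S \<subseteq> T" "C_k_on k S f" "C_k_on k T g"
  shows "C_k_on k S (\<lambda>x. g (f x))"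
  using assms(4,5)
proof (induction k arbitrary: g)
  case 0
  then show ?case using assms(3) by (auto intro: continuous_on_compose2)
next
  case (Suc k)
  have D: "((\<lambda>x. g (f x)) has_derivative
      (\<lambda>v. frechet_derivative g (at (f x)) (frechet_derivative f (at x) v))) (at x)" if "x \<in> S" for x
    using that assms(3) Suc.prems
    by (intro has_derivative_compose[where f=f and g=g] C_k_on_has_derivative) auto
  show ?case
  proof (rule C_k_on_SucI[OF assms(1) D])
    fix v
    have "C_k_on k S f" using Suc.prems by (rule_tac C_k_on_Suc_D)
    then have "C_k_on k S (\<lambda>x. \<Sum>b\<in>Basis. (frechet_derivative f (at x) v \<bullet> b) *\<^sub>R
        frechet_derivative g (at (f x)) b)"
      by (intro C_k_on_sum C_k_on_scaleR C_k_on_bounded_linear[OF assms(1) bounded_linear_inner_left]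
          assms(1) finite_Basis C_k_on_frechet Suc.IH) (use Suc.prems in blast)+
    then show "C_k_on k S (\<lambda>x. frechet_derivative g (at (f x)) (frechet_derivative f (at x) v))"
    proof (rule C_k_on_cong[OF assms(1), rotated])
      fix x assume "x \<in> S"
      then have "linear (frechet_derivative g (at (f x)))"
        using Suc.prems(2) assms(3) by (auto intro!: linear_frechet_derivative)
      then show "(\<Sum>b\<in>Basis. (frechet_derivative f (at x) v \<bullet> b) *\<^sub>R
          frechet_derivative g (at (f x)) b) =
          frechet_derivative g (at (f x)) (frechet_derivative f (at x) v)"
        by (rule linear_basis_expansion[symmetric])
    qed
  qed
qed

lemma C_k_on_affine:
  assumes "open S" "bounded_linear L"
  shows "C_k_on k S (\<lambda>x. a + L x)"
proof -
  have "C_k_on k S (\<lambda>x. x)"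
  proof (cases k)
    case (Suc j)
    have "C_k_on (Suc j) S (\<lambda>x. x)"
      by (rule C_k_on_SucI[OF assms(1) has_derivative_ident]) (rule C_k_on_const[OF assms(1)])
    then show ?thesis using Suc by simp
  qed simp
  then show ?thesis
    by (intro C_k_on_add C_k_on_bounded_linear[OF assms] C_k_on_const assms)
qed

lemma smooth_on_affine_compose:
  fixes f :: "'b::euclidean_space \<Rightarrow> 'c::real_normed_vector" and L :: "'a::euclidean_space \<Rightarrow> 'b"
  assumes "open S" "open T" "bounded_linear L" "\<And>x. x \<in> S \<Longrightarrow> a + L x \<in> T" "smooth_on T f"
  shows "smooth_on S (\<lambda>x. f (a + L x))"
  unfolding smooth_on_def
proof
  fix k
  show "C_k_on k S (\<lambda>x. f (a + L x))"
    by (rule C_k_on_compose[OF assms(1,2) _ C_k_on_affine[OF assms(1,3)]])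
      (use assms(4,5) in \<open>auto simp: smooth_on_def\<close>)
qed

section \<open>Second order geometry of closed submanifolds\<close>

lemma frechet_bounded_on_compact:
  fixes f :: "'a::euclidean_space \<Rightarrow> 'b::real_normed_vector"
  assumes "C_k_on 1 V f" "compact K" "K \<subseteq> V"
  shows "\<exists>B\<ge>0. \<forall>x\<in>K. \<forall>v. norm (frechet_derivative f (at x) v) \<le> B * norm v"
proof -
  let ?g = "\<lambda>x. \<Sum>b\<in>Basis. norm (frechet_derivative f (at x) b)"
  have "continuous_on K ?g"
    using assms by (auto intro!: continuous_intros intro: continuous_on_subset)
  then have "bounded (?g ` K)" using assms(2) compact_continuous_image compact_imp_bounded by blast
  then obtain B where "0 < B" "\<forall>y \<in> ?g ` K. norm y \<le> B" unfolding bounded_pos by blast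
  then have B: "0 < B" "\<And>x. x \<in> K \<Longrightarrow> ?g x \<le> B" by auto
  have "norm (frechet_derivative f (at x) v) \<le> B * norm v" if "x \<in> K" for x v
  proof -
    have "linear (frechet_derivative f (at x))"
      using that assms by (auto intro!: linear_frechet_derivative)
    then have "norm (frechet_derivative f (at x) v)
        = norm (\<Sum>b\<in>Basis. (v \<bullet> b) *\<^sub>R frechet_derivative f (at x) b)"
      by (rule arg_cong[OF linear_basis_expansion])
    also have "\<dots> \<le> (\<Sum>b\<in>Basis. norm v * norm (frechet_derivative f (at x) b))"
      by (rule order_trans[OF norm_sum sum_mono]) (auto intro!: mult_right_mono Basis_le_norm)
    also have "\<dots> = norm v * ?g x" by (simp add: sum_distrib_left)
    also have "\<dots> \<le> norm v * B" using B(2)[OF that] by (intro mult_left_mono) auto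
    finally show ?thesis by (simp add: mult.commute)
  qed
  with B(1) show ?thesis by (intro exI[of _ B]) auto
qed

lemma lipschitz_on_compact_convex:
  fixes f :: "'a::euclidean_space \<Rightarrow> 'b::real_normed_vector"
  assumes "C_k_on 1 V f" "compact K" "convex K" "K \<subseteq> V"
  shows "\<exists>B\<ge>0. \<forall>x\<in>K. \<forall>y\<in>K. norm (f x - f y) \<le> B * norm (x - y)"
proof -
  obtain B where B: "0 \<le> B" "\<And>x v. x \<in> K \<Longrightarrow> norm (frechet_derivative f (at x) v) \<le> B * norm v"
    using frechet_bounded_on_compact[OF assms(1,2,4)] by blast
  have "norm (f x - f y) \<le> B * norm (x - y)" if "x \<in> K" "y \<in> K" for x y
  proof (rule differentiable_bound[OF assms(3) _ _ that])
    fix z assume "z \<in> K"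
    show "(f has_derivative frechet_derivative f (at z)) (at z within K)"
      using \<open>z \<in> K\<close> assms(1,4)
      by (auto intro!: has_derivative_at_withinI[OF C_k_on_has_derivative[of 0 V]])
    show "onorm (frechet_derivative f (at z)) \<le> B"
      using B \<open>z \<in> K\<close> by (intro onorm_bound) auto
  qed
  with B(1) show ?thesis by blast
qed

lemma quadratic_remainder_on_compact_convex:
  fixes f :: "'a::euclidean_space \<Rightarrow> 'b::real_normed_vector"
  assumes "C_k_on 2 V f" "compact K" "convex K" "K \<subseteq> V"
  shows "\<exists>M\<ge>0. \<forall>x\<in>K. \<forall>y\<in>K.
    norm (f y - f x - frechet_derivative f (at x) (y - x)) \<le> M * (norm (y - x))\<^sup>2"
proof -
  let ?D = "\<lambda>x. frechet_derivative f (at x)"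
  have C1: "C_k_on 1 V (\<lambda>x. ?D x b)" for b
    using assms(1) by (simp add: numeral_2_eq_2)
  have D: "(f has_derivative ?D x) (at x)" if "x \<in> K" for x
    using that assms(1,4) by (intro C_k_on_has_derivative[of 1 V]) (auto simp: numeral_2_eq_2)
  have "\<exists>B\<ge>0. \<forall>x\<in>K. \<forall>y\<in>K. norm (?D x b - ?D y b) \<le> B * norm (x - y)" for b
    by (rule lipschitz_on_compact_convex[OF C1[of b] assms(2-4)])
  then obtain B where B: "\<And>b. 0 \<le> B b"
      "\<And>b x y. x \<in> K \<Longrightarrow> y \<in> K \<Longrightarrow> norm (?D x b - ?D y b) \<le> B b * norm (x - y)"
    by metis
  define M where "M = (\<Sum>b\<in>Basis. B b)"
  have M0: "0 \<le> M" unfolding M_def by (intro sum_nonneg B)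
  have lip: "norm (?D z v - ?D x v) \<le> M * norm (z - x) * norm v" if "x \<in> K" "z \<in> K" for x z v
  proof -
    have "?D z v - ?D x v = (\<Sum>b\<in>Basis. (v \<bullet> b) *\<^sub>R (?D z b - ?D x b))"
      using linear_basis_expansion[OF has_derivative_linear[OF D[OF that(1)]], of v]
        linear_basis_expansion[OF has_derivative_linear[OF D[OF that(2)]], of v]
      by (simp add: scaleR_diff_right sum_subtractf)
    also have "norm \<dots> \<le> (\<Sum>b\<in>Basis. norm v * (B b * norm (z - x)))"
      by (rule order_trans[OF norm_sum sum_mono])
        (use that B in \<open>auto intro!: mult_mono Basis_le_norm\<close>)
    finally show ?thesis
      by (simp add: M_def sum_distrib_left sum_distrib_right mult_ac)
  qed
  have "norm (f y - f x - ?D x (y - x)) \<le> M * (norm (y - x))\<^sup>2" if "x \<in> K" "y \<in> K" for x y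
  proof -
    have seg: "closed_segment x y \<subseteq> K" using assms(3) that by (simp add: closed_segment_subset)
    have bl: "bounded_linear (?D x)" using D[OF that(1)] has_derivative_bounded_linear by blast
    have "norm ((f y - ?D x y) - (f x - ?D x x)) \<le> (M * norm (y - x)) * norm (y - x)"
    proof (rule differentiable_bound[where S = "closed_segment x y"])
      fix z assume z: "z \<in> closed_segment x y"
      then have zK: "z \<in> K" using seg by blast
      show "((\<lambda>z. f z - ?D x z) has_derivative (\<lambda>v. ?D z v - ?D x v)) (at z within closed_segment x y)"
        by (intro has_derivative_diff has_derivative_at_withinI[OF D[OF zK]]
            bounded_linear_imp_has_derivative bl)
      have "norm (z - x) \<le> norm (y - x)" using segment_bound1[OF z] .
      then have "M * norm (z - x) \<le> M * norm (y - x)" using M0 by (intro mult_left_mono)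
      then show "onorm (\<lambda>v. ?D z v - ?D x v) \<le> M * norm (y - x)"
        using lip[OF that(1) zK] M0
        by (intro onorm_bound order_trans[OF lip[OF that(1) zK]]) (auto intro!: mult_right_mono)
    qed auto
    then show ?thesis
      by (simp add: linear_diff[OF bounded_linear.linear[OF bl]] power2_eq_square algebra_simps)
  qed
  with M0 show ?thesis by blast
qed

lemma has_vector_derivative_quotient:
  assumes "(c has_vector_derivative c') (at t)"
  shows "((\<lambda>h. (c (t + h) - c t) /\<^sub>R h) \<longlongrightarrow> c') (at 0)"
proof -
  have "((\<lambda>h. norm (c (t + h) - c t - h *\<^sub>R c') / norm h) \<longlongrightarrow> 0) (at 0)"
    using assms unfolding has_vector_derivative_def has_derivative_at by blast
  moreover have "\<forall>\<^sub>F h in at 0. norm (c (t + h) - c t - h *\<^sub>R c') / norm h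
      = norm ((c (t + h) - c t) /\<^sub>R h - c')"
    unfolding eventually_at_filter
  proof (rule always_eventually, intro allI impI)
    fix h :: real assume "h \<noteq> 0"
    then have "(c (t + h) - c t) /\<^sub>R h - c' = (c (t + h) - c t - h *\<^sub>R c') /\<^sub>R h"
      by (simp add: scaleR_diff_right)
    then show "norm (c (t + h) - c t - h *\<^sub>R c') / norm h = norm ((c (t + h) - c t) /\<^sub>R h - c')"
      by (simp add: divide_inverse mult.commute)
  qed
  ultimately have "((\<lambda>h. norm ((c (t + h) - c t) /\<^sub>R h - c')) \<longlongrightarrow> 0) (at 0)"
    by (rule Lim_transform_eventually)
  then show ?thesis by (rule LIM_zero_cancel[OF tendsto_norm_zero_cancel])
qed

lemma vector_derivative_in_subspace:
  fixes c :: "real \<Rightarrow> 'b::euclidean_space"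
  assumes "subspace L" "(c has_vector_derivative c') (at 0)"
    and "\<forall>\<^sub>F t in at 0. c t \<in> L" "c 0 \<in> L"
  shows "c' \<in> L"
proof (rule Lim_in_closed_set[OF closed_subspace[OF assms(1)] _ _ has_vector_derivative_quotient[OF assms(2)]])
  show "\<forall>\<^sub>F h in at 0. (c (0 + h) - c 0) /\<^sub>R h \<in> L"
    using assms(3) by eventually_elim (simp add: assms(1,4) subspace_scale subspace_diff)
qed simp

locale slice_chart =
  fixes N U V :: "'b::euclidean_space set" and \<phi> \<psi> :: "'b \<Rightarrow> 'b" and L :: "'b set"
  assumes open_U: "open U" and open_V: "open V" and homeo: "homeomorphism U V \<phi> \<psi>"
    and smooth_\<phi>: "smooth_on U \<phi>" and smooth_\<psi>: "smooth_on V \<psi>"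
    and subspace_L: "subspace L" and slice: "\<phi> ` (N \<inter> U) = L \<inter> V"
begin

abbreviation "D\<phi> q \<equiv> frechet_derivative \<phi> (at q)"
abbreviation "D\<psi> y \<equiv> frechet_derivative \<psi> (at y)"

lemma \<phi>_in: "q \<in> U \<Longrightarrow> \<phi> q \<in> V" and \<psi>_in: "y \<in> V \<Longrightarrow> \<psi> y \<in> U"
  and \<psi>\<phi>: "q \<in> U \<Longrightarrow> \<psi> (\<phi> q) = q" and \<phi>\<psi>: "y \<in> V \<Longrightarrow> \<phi> (\<psi> y) = y"
  using homeo unfolding homeomorphism_def by auto

lemma \<phi>_in_L: "q \<in> N \<Longrightarrow> q \<in> U \<Longrightarrow> \<phi> q \<in> L"
  using slice by auto

lemma \<psi>_in_N: assumes "y \<in> L" "y \<in> V" shows "\<psi> y \<in> N"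
proof -
  obtain q where "q \<in> N" "q \<in> U" "y = \<phi> q" using slice assms by blast
  then show ?thesis by (simp add: \<psi>\<phi>)
qed

lemma has_derivative_\<phi>: "q \<in> U \<Longrightarrow> (\<phi> has_derivative D\<phi> q) (at q)"
  and has_derivative_\<psi>: "y \<in> V \<Longrightarrow> (\<psi> has_derivative D\<psi> y) (at y)"
  using smooth_\<phi> smooth_\<psi> unfolding smooth_on_def by (blast intro: C_k_on_has_derivative)+

lemma D\<psi>_D\<phi>: assumes "q \<in> U" shows "D\<psi> (\<phi> q) (D\<phi> q v) = v"
proof -
  have "((\<lambda>x. \<psi> (\<phi> x)) has_derivative (\<lambda>v. D\<psi> (\<phi> q) (D\<phi> q v))) (at q)"
    using assms by (intro has_derivative_compose[where f=\<phi> and g=\<psi>] has_derivative_\<phi> has_derivative_\<psi> \<phi>_in)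
  then have "((\<lambda>x. x) has_derivative (\<lambda>v. D\<psi> (\<phi> q) (D\<phi> q v))) (at q)"
    by (rule has_derivative_transform_within_open[OF _ open_U assms]) (simp add: \<psi>\<phi>)
  then have "(\<lambda>v. D\<psi> (\<phi> q) (D\<phi> q v)) = (\<lambda>v. v)"
    using has_derivative_unique has_derivative_ident by blast
  then show ?thesis by metis
qed

lemma D\<phi>_D\<psi>: assumes "y \<in> V" shows "D\<phi> (\<psi> y) (D\<psi> y v) = v"
proof -
  have "((\<lambda>x. \<phi> (\<psi> x)) has_derivative (\<lambda>v. D\<phi> (\<psi> y) (D\<psi> y v))) (at y)"
    using assms by (intro has_derivative_compose[where f=\<psi> and g=\<phi>] has_derivative_\<phi> has_derivative_\<psi> \<psi>_in)
  then have "((\<lambda>x. x) has_derivative (\<lambda>v. D\<phi> (\<psi> y) (D\<psi> y v))) (at y)"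
    by (rule has_derivative_transform_within_open[OF _ open_V assms]) (simp add: \<phi>\<psi>)
  then have "(\<lambda>v. D\<phi> (\<psi> y) (D\<psi> y v)) = (\<lambda>v. v)"
    using has_derivative_unique has_derivative_ident by blast
  then show ?thesis by metis
qed

lemma linear_D\<phi>: "q \<in> U \<Longrightarrow> linear (D\<phi> q)"
  by (rule has_derivative_linear[OF has_derivative_\<phi>])

lemma D\<phi>_tangent:
  assumes "q \<in> U" "v \<in> tangent_space N q"
  shows "D\<phi> q v \<in> L"
proof -
  obtain \<gamma> e where \<gamma>: "0 < e" "\<gamma> ` {-e<..<e} \<subseteq> N" "\<gamma> 0 = q"
      "(\<gamma> has_vector_derivative v) (at (0::real))"
    using assms(2) unfolding tangent_space_def by blast
  have "(\<phi> has_derivative D\<phi> q) (at (\<gamma> 0))" using has_derivative_\<phi> assms(1) \<gamma>(3) by simp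
  then have d: "((\<phi> \<circ> \<gamma>) has_vector_derivative D\<phi> q v) (at 0)"
    by (rule vector_derivative_diff_chain_within[OF \<gamma>(4) has_derivative_at_withinI])
  have "(\<gamma> \<longlongrightarrow> q) (at 0)"
    using has_vector_derivative_continuous[OF \<gamma>(4)] \<gamma>(3) by (simp add: isCont_def)
  then have "\<forall>\<^sub>F t in at 0. \<gamma> t \<in> U"
    using assms(1) open_U topological_tendstoD by blast
  moreover have "\<forall>\<^sub>F t in at 0. t \<in> {-e<..<e}"
    using \<gamma>(1) by (intro eventually_at_in_open') auto
  ultimately have "\<forall>\<^sub>F t in at 0. (\<phi> \<circ> \<gamma>) t \<in> L"
  proof eventually_elim
    case (elim t)
    then show ?case using \<gamma>(2) by (auto intro!: \<phi>_in_L)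
  qed
  moreover have "(\<phi> \<circ> \<gamma>) 0 \<in> L"
    using \<gamma> assms(1) by (force intro!: \<phi>_in_L)
  ultimately show ?thesis
    using vector_derivative_in_subspace[OF subspace_L d] by blast
qed

lemma tangent_if_D\<phi>:
  assumes q: "q \<in> N" "q \<in> U" and "D\<phi> q v \<in> L"
  shows "v \<in> tangent_space N q"
proof -
  let ?b = "D\<phi> q v"
  let ?c = "\<lambda>t::real. \<phi> q + t *\<^sub>R ?b"
  have "(?c \<longlongrightarrow> \<phi> q + 0 *\<^sub>R ?b) (at 0)" by (intro tendsto_intros)
  then have "\<forall>\<^sub>F t in at 0. ?c t \<in> V"
    using \<phi>_in[OF q(2)] open_V topological_tendstoD by fastforce
  then obtain e where e: "0 < e" "\<And>t. t \<noteq> 0 \<Longrightarrow> \<bar>t\<bar> < e \<Longrightarrow> ?c t \<in> V"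
    by (auto simp: eventually_at dist_real_def)
  have cV: "?c t \<in> V" if "t \<in> {-e<..<e}" for t
    using that e(2)[of t] \<phi>_in[OF q(2)] by (cases "t = 0") auto
  have cL: "?c t \<in> L" for t
    using \<phi>_in_L[OF q] assms(3) subspace_L by (simp add: subspace_add subspace_scale)
  let ?\<gamma> = "\<lambda>t. \<psi> (?c t)"
  have "smooth_on {-e<..<e} ?\<gamma>"
    by (rule smooth_on_affine_compose[OF _ open_V bounded_linear_scaleR_left _ smooth_\<psi>])
      (use cV in auto)
  moreover have "?\<gamma> ` {-e<..<e} \<subseteq> N"
    using \<psi>_in_N cV cL by blast
  moreover have "?\<gamma> 0 = q" using q by (simp add: \<psi>\<phi>)
  moreover have "(?\<gamma> has_vector_derivative v) (at 0)"
  proof -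
    have "(?c has_vector_derivative ?b) (at 0)"
      by (auto intro!: derivative_eq_intros)
    moreover have "(\<psi> has_derivative D\<psi> (\<phi> q)) (at (?c 0))"
      using has_derivative_\<psi> \<phi>_in q by simp
    ultimately have "((\<psi> \<circ> ?c) has_vector_derivative D\<psi> (\<phi> q) ?b) (at 0)"
      by (rule vector_derivative_diff_chain_within[OF _ has_derivative_at_withinI])
    then show ?thesis by (simp add: o_def D\<psi>_D\<phi> q)
  qed
  ultimately show ?thesis
    unfolding tangent_space_def using e(1) by blast
qed

lemma tangent_iff:
  "q \<in> N \<Longrightarrow> q \<in> U \<Longrightarrow> v \<in> tangent_space N q \<longleftrightarrow> D\<phi> q v \<in> L"
  using D\<phi>_tangent tangent_if_D\<phi> by blast

lemma subspace_tangent: "q \<in> N \<Longrightarrow> q \<in> U \<Longrightarrow> subspace (tangent_space N q)"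
  using subspace_L linear_D\<phi>[of q]
  by (auto simp: subspace_def tangent_iff linear_0 linear_add linear_cmul)

lemma tangent_extension:
  assumes q: "q \<in> N" "q \<in> U" and w: "w \<in> tangent_space N q"
  obtains W where "smooth_on U W" "\<And>q. q \<in> N \<Longrightarrow> q \<in> U \<Longrightarrow> W q \<in> tangent_space N q" "W q = w"
proof
  let ?W = "\<lambda>x. D\<psi> (\<phi> x) (D\<phi> q w)"
  show "smooth_on U ?W"
    unfolding smooth_on_def
  proof
    fix k
    have C: "C_k_on (Suc k) V \<psi>" "C_k_on k U \<phi>"
      using smooth_\<psi> smooth_\<phi> by (auto simp: smooth_on_def simp del: C_k_on.simps)
    show "C_k_on k U ?W"
      using \<phi>_in by (intro C_k_on_compose[OF open_U open_V _ C(2) C_k_on_frechet[OF C(1)]]) auto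
  qed
  show "?W p \<in> tangent_space N p" if "p \<in> N" "p \<in> U" for p
    using that D\<phi>_D\<psi>[OF \<phi>_in[of p]] D\<phi>_tangent[OF q(2) w] by (simp add: tangent_iff \<psi>\<phi>)
  show "?W q = w" by (simp add: D\<psi>_D\<phi> q)
qed

lemma derivative_tangent_field_vanishing:
  assumes q: "q \<in> N" "q \<in> U" and v: "v \<in> tangent_space N q"
    and X: "(X has_derivative X') (at q)" "X q = 0"
    and "open T" "q \<in> T" "\<And>p. p \<in> N \<inter> T \<Longrightarrow> X p \<in> tangent_space N p"
  shows "X' v \<in> tangent_space N q"
proof -
  obtain \<gamma> e where \<gamma>: "0 < e" "\<gamma> ` {-e<..<e} \<subseteq> N" "\<gamma> 0 = q"
      "(\<gamma> has_vector_derivative v) (at (0::real))"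
    using v unfolding tangent_space_def by blast
  have lim\<gamma>: "(\<gamma> \<longlongrightarrow> q) (at 0)"
    using has_vector_derivative_continuous[OF \<gamma>(4)] \<gamma>(3) by (simp add: isCont_def)
  then have "\<forall>\<^sub>F t in at 0. \<gamma> t \<in> U \<inter> T"
    using q(2) assms(7) open_U \<open>open T\<close> by (intro topological_tendstoD) auto
  moreover have "\<forall>\<^sub>F t in at 0. t \<in> {-e<..<e}"
    using \<gamma>(1) by (intro eventually_at_in_open') auto
  ultimately have ev: "\<forall>\<^sub>F t in at 0. D\<phi> (\<gamma> t) (X (\<gamma> t) /\<^sub>R t) \<in> L"
  proof eventually_elim
    case (elim t)
    then have "\<gamma> t \<in> N" using \<gamma>(2) by auto
    then have "D\<phi> (\<gamma> t) (X (\<gamma> t)) \<in> L" using elim assms(8) by (auto intro!: D\<phi>_tangent)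
    then show ?case
      using elim linear_D\<phi> subspace_L by (simp add: linear_cmul subspace_scale)
  qed
  have "((X \<circ> \<gamma>) has_vector_derivative X' v) (at 0)"
    using X(1) \<gamma>(3) by (intro vector_derivative_diff_chain_within[OF \<gamma>(4) has_derivative_at_withinI]) simp
  from has_vector_derivative_quotient[OF this]
  have lim: "((\<lambda>t. X (\<gamma> t) /\<^sub>R t) \<longlongrightarrow> X' v) (at 0)"
    by (simp add: \<gamma>(3) X(2))
  have cont: "((\<lambda>t. D\<phi> (\<gamma> t) b) \<longlongrightarrow> D\<phi> q b) (at 0)" for b
  proof -
    have "C_k_on (Suc 0) U \<phi>" using smooth_\<phi> by (simp add: smooth_on_def del: C_k_on.simps)
    then have "continuous_on U (\<lambda>x. D\<phi> x b)" by simp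
    then have "isCont (\<lambda>x. D\<phi> x b) q" using open_U q(2) continuous_on_eq_continuous_at by blast
    then show ?thesis using lim\<gamma> by (rule isCont_tendsto_compose)
  qed
  have "((\<lambda>t. \<Sum>b\<in>Basis. ((X (\<gamma> t) /\<^sub>R t) \<bullet> b) *\<^sub>R D\<phi> (\<gamma> t) b) \<longlongrightarrow>
      (\<Sum>b\<in>Basis. (X' v \<bullet> b) *\<^sub>R D\<phi> q b)) (at 0)"
    by (intro tendsto_sum tendsto_scaleR tendsto_inner lim cont tendsto_const)
  then have "((\<lambda>t. \<Sum>b\<in>Basis. ((X (\<gamma> t) /\<^sub>R t) \<bullet> b) *\<^sub>R D\<phi> (\<gamma> t) b) \<longlongrightarrow> D\<phi> q (X' v)) (at 0)"
    by (simp only: linear_basis_expansion[OF linear_D\<phi>[OF q(2)], symmetric])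
  moreover have "\<forall>\<^sub>F t in at 0. (\<Sum>b\<in>Basis. ((X (\<gamma> t) /\<^sub>R t) \<bullet> b) *\<^sub>R D\<phi> (\<gamma> t) b) \<in> L"
    using ev \<open>\<forall>\<^sub>F t in at 0. \<gamma> t \<in> U \<inter> T\<close>
  proof eventually_elim
    case (elim t)
    then show ?case by (simp only: linear_basis_expansion[OF linear_D\<phi>, symmetric] Int_iff)
  qed
  ultimately have "D\<phi> q (X' v) \<in> L"
    by (rule Lim_in_closed_set[OF closed_subspace[OF subspace_L], rotated 2]) simp
  then show ?thesis using q tangent_iff by blast
qed

lemma second_fundamental_form_normal:
  assumes q: "q \<in> N" "q \<in> U" and v: "v \<in> tangent_space N q" and w: "w \<in> tangent_space N q"
  shows "second_fundamental_form N q v w \<in> (tangent_space N q)\<^sup>\<bottom>"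
proof -
  let ?T = "tangent_space N q"
  have sub: "subspace ?T" by (rule subspace_tangent[OF q])
  let ?P = "\<lambda>a. \<exists>U W. open U \<and> q \<in> U \<and> smooth_on U W \<and>
        (\<forall>q \<in> N \<inter> U. W q \<in> tangent_space N q) \<and> W q = w \<and>
        a \<in> ?T\<^sup>\<bottom> \<and> frechet_derivative W (at q) v + a \<in> ?T"
  obtain W where W: "smooth_on U W" "\<And>q. q \<in> N \<Longrightarrow> q \<in> U \<Longrightarrow> W q \<in> tangent_space N q" "W q = w"
    using tangent_extension[OF q w] by metis
  obtain y z where yz: "y \<in> span ?T" "\<And>w. w \<in> span ?T \<Longrightarrow> orthogonal z w"
      "frechet_derivative W (at q) v = y + z"
    using orthogonal_subspace_decomp_exists by blast
  have span: "span ?T = ?T" using sub by simp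
  have "- z \<in> ?T\<^sup>\<bottom>" using yz(2) span by (auto simp: orthogonal_comp_def orthogonal_def inner_commute)
  then have P: "?P (- z)"
    using W q open_U yz(1,3) span by (intro exI[of _ U] exI[of _ W]) auto
  have unique: "a = a'" if a: "?P a" and a': "?P a'" for a a'
  proof -
    obtain S Y where Y: "open S" "q \<in> S" "smooth_on S Y" "\<And>q. q \<in> N \<inter> S \<Longrightarrow> Y q \<in> tangent_space N q"
        "Y q = w" "a \<in> ?T\<^sup>\<bottom>" "frechet_derivative Y (at q) v + a \<in> ?T"
      using a by blast
    obtain S' Y' where Y': "open S'" "q \<in> S'" "smooth_on S' Y'" "\<And>q. q \<in> N \<inter> S' \<Longrightarrow> Y' q \<in> tangent_space N q"
        "Y' q = w" "a' \<in> ?T\<^sup>\<bottom>" "frechet_derivative Y' (at q) v + a' \<in> ?T"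
      using a' by blast
    have D: "(Y has_derivative frechet_derivative Y (at q)) (at q)"
      "(Y' has_derivative frechet_derivative Y' (at q)) (at q)"
      using Y Y' unfolding smooth_on_def by (blast intro: C_k_on_has_derivative)+
    have "frechet_derivative Y (at q) v - frechet_derivative Y' (at q) v \<in> ?T"
      using Y Y' open_U q
      by (intro derivative_tangent_field_vanishing[OF q v has_derivative_diff[OF D], where T = "U \<inter> S \<inter> S'"])
        (auto intro!: subspace_diff[OF subspace_tangent])
    then have "(frechet_derivative Y (at q) v + a) - (frechet_derivative Y' (at q) v + a')
        - (frechet_derivative Y (at q) v - frechet_derivative Y' (at q) v) \<in> ?T"
      using Y(7) Y'(7) sub by (blast intro: subspace_diff)
    then have "a - a' \<in> ?T" by (simp add: algebra_simps)
    moreover have "a - a' \<in> ?T\<^sup>\<bottom>"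
      using Y(6) Y'(6) by (simp add: subspace_diff subspace_orthogonal_comp)
    ultimately have "(a - a') \<bullet> (a - a') = 0"
      by (auto simp: orthogonal_comp_def orthogonal_def)
    then show "a = a'" by simp
  qed
  have "?P (THE a. ?P a)" by (rule theI[of ?P, OF P]) (rule unique[OF _ P])
  then show ?thesis unfolding second_fundamental_form_def by blast
qed

lemma normal_quadratic_local:
  assumes p: "p \<in> N" "p \<in> U"
  obtains d C where "0 < d" "0 \<le> C"
    "\<And>q r \<nu>. \<lbrakk>q \<in> N; r \<in> N; dist p q < d; dist p r < d; \<nu> \<in> (tangent_space N q)\<^sup>\<bottom>\<rbrakk>
      \<Longrightarrow> \<bar>(r - q) \<bullet> \<nu>\<bar> \<le> C * norm \<nu> * (norm (r - q))\<^sup>2"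
proof -
  obtain e where e: "0 < e" "cball (\<phi> p) e \<subseteq> V"
    using open_V \<phi>_in[OF p(2)] open_contains_cball by blast
  have C2: "C_k_on 2 V \<psi>" using smooth_\<psi> by (simp add: smooth_on_def)
  obtain M where M: "0 \<le> M" "\<And>x y. x \<in> cball (\<phi> p) e \<Longrightarrow> y \<in> cball (\<phi> p) e \<Longrightarrow>
      norm (\<psi> y - \<psi> x - D\<psi> x (y - x)) \<le> M * (norm (y - x))\<^sup>2"
    using quadratic_remainder_on_compact_convex[OF C2 compact_cball convex_cball e(2)] by blast
  have C1: "C_k_on 1 U \<phi>" using smooth_\<phi> by (simp add: smooth_on_def del: C_k_on.simps)
  then have "continuous_on U \<phi>" by (rule C_k_on_imp_continuous_on)
  then have "isCont \<phi> p" using open_U p(2) continuous_on_eq_continuous_at by blast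
  then obtain d1 where d1: "0 < d1" "\<And>q. dist q p < d1 \<Longrightarrow> dist (\<phi> q) (\<phi> p) < e"
    using e(1) unfolding continuous_at_eps_delta by blast
  obtain d2 where d2: "0 < d2" "cball p d2 \<subseteq> U"
    using open_U p(2) open_contains_cball by blast
  obtain B where B: "0 \<le> B"
      "\<And>x y. x \<in> cball p d2 \<Longrightarrow> y \<in> cball p d2 \<Longrightarrow> norm (\<phi> x - \<phi> y) \<le> B * norm (x - y)"
    using lipschitz_on_compact_convex[OF C1 compact_cball convex_cball d2(2)] by blast
  show thesis
  proof (rule that[of "min d1 d2" "M * B\<^sup>2"])
    fix q r \<nu>
    assume qr: "q \<in> N" "r \<in> N" "dist p q < min d1 d2" "dist p r < min d1 d2"
      and \<nu>: "\<nu> \<in> (tangent_space N q)\<^sup>\<bottom>"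
    have U: "q \<in> U" "r \<in> U" using qr d2 by (auto simp: subset_iff)
    have K: "\<phi> q \<in> cball (\<phi> p) e" "\<phi> r \<in> cball (\<phi> p) e"
      using qr d1(2)[of q] d1(2)[of r] by (auto simp: dist_commute)
    let ?y = "\<phi> r - \<phi> q"
    have "D\<psi> (\<phi> q) ?y \<in> tangent_space N q"
      using D\<phi>_D\<psi>[OF \<phi>_in[OF U(1)], of ?y] subspace_diff[OF subspace_L \<phi>_in_L[OF qr(2) U(2)] \<phi>_in_L[OF qr(1) U(1)]]
      by (simp add: tangent_iff qr U \<psi>\<phi>)
    then have "D\<psi> (\<phi> q) ?y \<bullet> \<nu> = 0"
      using \<nu> by (auto simp: orthogonal_comp_def orthogonal_def)
    then have "(r - q) \<bullet> \<nu> = (\<psi> (\<phi> r) - \<psi> (\<phi> q) - D\<psi> (\<phi> q) ?y) \<bullet> \<nu>"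
      by (simp add: \<psi>\<phi> U inner_diff_left)
    also have "\<bar>\<dots>\<bar> \<le> norm (\<psi> (\<phi> r) - \<psi> (\<phi> q) - D\<psi> (\<phi> q) ?y) * norm \<nu>"
      by (rule Cauchy_Schwarz_ineq2)
    also have "\<dots> \<le> (M * (norm ?y)\<^sup>2) * norm \<nu>"
      using M(2)[OF K] by (intro mult_right_mono) auto
    also have "\<dots> \<le> (M * (B * norm (r - q))\<^sup>2) * norm \<nu>"
      using B(2)[of r q] qr M(1) by (intro mult_right_mono mult_left_mono power_mono) auto
    finally show "\<bar>(r - q) \<bullet> \<nu>\<bar> \<le> M * B\<^sup>2 * norm \<nu> * (norm (r - q))\<^sup>2"
      by (simp add: power_mult_distrib mult_ac)
  qed (use d1 d2 M in auto)
qed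

end

lemma submanifold_slice_chart:
  assumes "submanifold d N" "p \<in> N"
  obtains U V \<phi> \<psi> L where "slice_chart N U V \<phi> \<psi> L" "p \<in> U"
  using assms unfolding submanifold_def slice_chart_def by metis

lemma submanifold_second_fundamental_form_normal:
  assumes "submanifold d N" "p \<in> N" "v \<in> tangent_space N p" "w \<in> tangent_space N p"
  shows "second_fundamental_form N p v w \<in> (tangent_space N p)\<^sup>\<bottom>"
  using assms by (metis submanifold_slice_chart slice_chart.second_fundamental_form_normal)

lemma compact_submanifold_normal_quadratic:
  assumes "submanifold d N" "compact N"
  obtains C where "0 < C"
    "\<And>p q \<nu>. p \<in> N \<Longrightarrow> q \<in> N \<Longrightarrow> \<nu> \<in> (tangent_space N p)\<^sup>\<bottom>
      \<Longrightarrow> \<bar>(q - p) \<bullet> \<nu>\<bar> \<le> C * norm \<nu> * (norm (q - p))\<^sup>2"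
proof -
  have "\<exists>d C. 0 < d \<and> 0 \<le> C \<and> (\<forall>q r \<nu>. q \<in> N \<longrightarrow> r \<in> N \<longrightarrow> dist p q < d \<longrightarrow> dist p r < d \<longrightarrow>
      \<nu> \<in> (tangent_space N q)\<^sup>\<bottom> \<longrightarrow> \<bar>(r - q) \<bullet> \<nu>\<bar> \<le> C * norm \<nu> * (norm (r - q))\<^sup>2)" if p: "p \<in> N" for p
  proof -
    obtain U V \<phi> \<psi> L where "slice_chart N U V \<phi> \<psi> L" "p \<in> U"
      using submanifold_slice_chart[OF assms(1) p] by blast
    then obtain d C where "0 < d" "0 \<le> C"
      "\<And>q r \<nu>. \<lbrakk>q \<in> N; r \<in> N; dist p q < d; dist p r < d; \<nu> \<in> (tangent_space N q)\<^sup>\<bottom>\<rbrakk>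
        \<Longrightarrow> \<bar>(r - q) \<bullet> \<nu>\<bar> \<le> C * norm \<nu> * (norm (r - q))\<^sup>2"
      using slice_chart.normal_quadratic_local[OF _ p] by metis
    then show ?thesis by blast
  qed
  then obtain d C where dC: "\<And>p. p \<in> N \<Longrightarrow> 0 < d p" "\<And>p. p \<in> N \<Longrightarrow> 0 \<le> C p"
    "\<And>p q r \<nu>. \<lbrakk>p \<in> N; q \<in> N; r \<in> N; dist p q < d p; dist p r < d p; \<nu> \<in> (tangent_space N q)\<^sup>\<bottom>\<rbrakk>
      \<Longrightarrow> \<bar>(r - q) \<bullet> \<nu>\<bar> \<le> C p * norm \<nu> * (norm (r - q))\<^sup>2"
    by metis
  have "N \<subseteq> (\<Union>p\<in>N. ball p (d p / 2))" using dC(1) by force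
  then obtain F where F: "F \<subseteq> N" "finite F" "N \<subseteq> (\<Union>p\<in>F. ball p (d p / 2))"
    using compactE_image[OF assms(2), of N "\<lambda>p. ball p (d p / 2)"] by auto
  define \<delta> where "\<delta> = Min (insert 1 ((\<lambda>p. d p / 2) ` F))"
  have \<delta>: "0 < \<delta>" "\<And>p. p \<in> F \<Longrightarrow> \<delta> \<le> d p / 2"
    unfolding \<delta>_def using F(1,2) dC(1) by (force, intro Min_le) auto
  define K where "K = (\<Sum>p\<in>F. C p) + 1 / \<delta>"
  have CK: "C p \<le> K" if "p \<in> F" for p
  proof -
    have "C p \<le> (\<Sum>p\<in>F. C p)" using that F dC(2) by (intro member_le_sum) auto
    then show ?thesis using \<delta>(1) by (simp add: K_def add_increasing2)
  qed
  have K\<delta>: "1 / \<delta> \<le> K" using F dC(2) by (auto simp: K_def intro!: sum_nonneg)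
  show thesis
  proof (rule that[of K])
    show "0 < K" using K\<delta> \<delta>(1) by (auto intro: less_le_trans[of _ "1 / \<delta>"])
    fix p q \<nu> assume pq: "p \<in> N" "q \<in> N" and \<nu>: "\<nu> \<in> (tangent_space N p)\<^sup>\<bottom>"
    show "\<bar>(q - p) \<bullet> \<nu>\<bar> \<le> K * norm \<nu> * (norm (q - p))\<^sup>2"
    proof (cases "dist p q < \<delta>")
      case True
      obtain z where z: "z \<in> F" "dist z p < d z / 2" using F(3) pq(1) by auto
      have "dist z q < d z" using dist_triangle[of z q p] z True \<delta>(2)[OF z(1)] by simp
      then have "\<bar>(q - p) \<bullet> \<nu>\<bar> \<le> C z * norm \<nu> * (norm (q - p))\<^sup>2"
        using z pq F(1) dC(1)[of z] \<nu> by (intro dC(3)) auto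
      also have "\<dots> \<le> K * norm \<nu> * (norm (q - p))\<^sup>2"
        using CK[OF z(1)] by (intro mult_right_mono) auto
      finally show ?thesis .
    next
      case False
      then have "1 \<le> norm (q - p) / \<delta>" using \<delta>(1) by (simp add: dist_norm norm_minus_commute)
      have "\<bar>(q - p) \<bullet> \<nu>\<bar> \<le> norm (q - p) * norm \<nu>" by (rule Cauchy_Schwarz_ineq2)
      also have "\<dots> \<le> norm (q - p) * norm \<nu> * (norm (q - p) / \<delta>)"
        using mult_left_mono[OF \<open>1 \<le> norm (q - p) / \<delta>\<close>, of "norm (q - p) * norm \<nu>"] by simp
      also have "\<dots> = (1 / \<delta>) * (norm \<nu> * (norm (q - p))\<^sup>2)" by (simp add: power2_eq_square)
      also have "\<dots> \<le> K * (norm \<nu> * (norm (q - p))\<^sup>2)" using K\<delta> by (intro mult_right_mono) auto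
      finally show ?thesis by (simp add: mult.assoc)
    qed
  qed
qed

section \<open>The difference of two flows\<close>

lemma second_derivative_nonpos_at_max:
  fixes k :: "real \<Rightarrow> real"
  assumes "0 < d" "\<And>s. \<bar>s\<bar> < d \<Longrightarrow> (k has_real_derivative k1 s) (at s)"
    and "(k1 has_real_derivative k2) (at 0)" "\<And>s. \<bar>s\<bar> < d \<Longrightarrow> k s \<le> k 0"
  shows "k2 \<le> 0"
proof (rule ccontr)
  assume "\<not> k2 \<le> 0"
  then have "0 < k2" by simp
  have "k1 0 = 0"
    using assms by (intro DERIV_local_max[of k _ 0 d]) auto
  moreover obtain e where e: "0 < e" "\<And>h. 0 < h \<Longrightarrow> h < e \<Longrightarrow> k1 0 < k1 (0 + h)"
    using DERIV_pos_inc_right[OF assms(3) \<open>0 < k2\<close>] by blast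
  ultimately have pos: "0 < k1 h" if "0 < h" "h < e" for h using that by auto
  define h where "h = min d e / 2"
  have h: "0 < h" "h < d" "h < e" using assms(1) e(1) by (auto simp: h_def)
  obtain z where z: "0 < z" "z < h" "k h - k 0 = (h - 0) * k1 z"
    using MVT2[of 0 h k k1] h assms(2) by force
  have "0 < h * k1 z" using pos[of z] z h by auto
  then show False using z assms(4)[of h] h by auto
qed

lemma smooth_on_partial_deriv:
  "smooth_on UNIV g \<Longrightarrow> smooth_on UNIV (partial_deriv i g)"
  unfolding smooth_on_def partial_deriv_def[abs_def] by (blast intro: C_k_on_frechet[of _ _ g])

lemma partial_deriv_along_line:
  assumes "smooth_on UNIV g"
  shows "((\<lambda>s. g (x + s *\<^sub>R axis i 1)) has_vector_derivative
    partial_deriv i g (x + s *\<^sub>R axis i 1)) (at s)"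
proof -
  have D: "(g has_derivative frechet_derivative g (at y)) (at y)" for y
    using assms unfolding smooth_on_def by (blast intro: C_k_on_has_derivative)
  have "(g \<circ> (\<lambda>s. x + s *\<^sub>R axis i 1) has_vector_derivative
      frechet_derivative g (at (x + s *\<^sub>R axis i 1)) (axis i 1)) (at s)"
    by (rule vector_derivative_diff_chain_within[OF _ has_derivative_at_withinI[OF D]])
      (auto intro!: derivative_eq_intros)
  then show ?thesis by (simp add: o_def partial_deriv_def)
qed

lemma norm_nabla_1_squared:
  fixes g :: "real^'n \<Rightarrow> 'b::real_normed_vector"
  shows "(norm_nabla 1 g x)\<^sup>2 = (\<Sum>i\<in>UNIV. (norm (partial_deriv i g x))\<^sup>2)"
proof -
  have "{is :: 'n list. length is = 1} = (\<lambda>i. [i]) ` UNIV"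
    by (auto simp: length_Suc_conv)
  then have "(\<Sum>is | length is = 1. (norm (foldr partial_deriv is g x))\<^sup>2)
      = (\<Sum>i\<in>UNIV. (norm (partial_deriv i g x))\<^sup>2)"
    by (simp add: sum.reindex inj_on_def del: One_nat_def)
  then show ?thesis
    by (simp add: norm_nabla_def sum_nonneg)
qed

lemma norm_partial_deriv_le: "norm (partial_deriv i g x) \<le> norm_nabla 1 g x"
proof (rule power2_le_imp_le)
  show "(norm (partial_deriv i g x))\<^sup>2 \<le> (norm_nabla 1 g x)\<^sup>2"
    unfolding norm_nabla_1_squared by (rule member_le_sum) auto
qed (simp add: norm_nabla_def sum_nonneg)

lemma norm_frechet_le_norm_nabla:
  fixes g :: "real^'n \<Rightarrow> 'b::real_normed_vector"
  assumes "g differentiable at x"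
  shows "norm (frechet_derivative g (at x) v) \<le> real CARD('n) * norm_nabla 1 g x * norm v"
proof -
  have "linear (frechet_derivative g (at x))" using assms by (rule linear_frechet_derivative)
  then have "frechet_derivative g (at x) v
      = (\<Sum>i\<in>UNIV. frechet_derivative g (at x) (v $ i *\<^sub>R axis i 1))"
    by (metis (no_types) basis_expansion linear_sum scalar_mult_eq_scaleR)
  also have "\<dots> = (\<Sum>i\<in>UNIV. (v $ i) *\<^sub>R partial_deriv i g x)"
    using \<open>linear _\<close> by (simp add: linear_cmul partial_deriv_def)
  also have "norm \<dots> \<le> (\<Sum>i\<in>(UNIV :: 'n set). norm v * norm_nabla 1 g x)"
    by (rule order_trans[OF norm_sum sum_mono])
      (auto intro!: mult_mono norm_partial_deriv_le simp: component_le_norm_cart simp del: One_nat_def)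
  finally show ?thesis by (simp add: mult_ac)
qed

abbreviation time_deriv :: "('a \<times> real \<Rightarrow> 'b::real_normed_vector) \<Rightarrow> 'a \<Rightarrow> real \<Rightarrow> 'b" where
  "time_deriv u x t \<equiv> vector_derivative (\<lambda>s. u (x, s)) (at t)"

lemma harmonic_map_flow_in: "harmonic_map_flow N u \<Longrightarrow> 0 < t \<Longrightarrow> u (x, t) \<in> N"
  unfolding harmonic_map_flow_def by auto

lemma open_spacetime: "open (UNIV \<times> {0::real<..})"
  by (intro open_Times) auto

lemma smooth_space_slice:
  assumes "harmonic_map_flow N u" "0 < t"
  shows "smooth_on UNIV (\<lambda>y. u (y, t))"
proof -
  have "smooth_on UNIV (\<lambda>y. u ((0, t) + (y, 0)))"
    by (rule smooth_on_affine_compose[OF open_UNIV open_spacetime])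
      (use assms in \<open>auto simp: harmonic_map_flow_def intro!: bounded_linear_Pair
        bounded_linear_ident bounded_linear_zero\<close>)
  then show ?thesis by simp
qed

lemma time_deriv_works:
  assumes "harmonic_map_flow N u" "0 < t"
  shows "((\<lambda>s. u (x, s)) has_vector_derivative time_deriv u x t) (at t)"
proof -
  have "smooth_on {0<..} (\<lambda>s. u ((x, 0) + (0, s)))"
    by (rule smooth_on_affine_compose[OF open_greaterThan open_spacetime])
      (use assms in \<open>auto simp: harmonic_map_flow_def intro!: bounded_linear_Pair
        bounded_linear_ident bounded_linear_zero\<close>)
  then have "C_k_on (Suc 0) {0<..} (\<lambda>s. u (x, s))" by (simp add: smooth_on_def del: C_k_on.simps)
  then have "(\<lambda>s. u (x, s)) differentiable (at t)" using assms(2) by simp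
  then show ?thesis using vector_derivative_works by blast
qed

lemma velocity_tangent:
  assumes u: "harmonic_map_flow N u" and L: "bounded_linear (L :: real \<Rightarrow> _)"
    and e: "0 < e" "\<And>s. \<bar>s\<bar> < e \<Longrightarrow> 0 < t + snd (L s)"
    and d: "((\<lambda>s. u ((x, t) + L s)) has_vector_derivative v) (at 0)"
  shows "v \<in> tangent_space N (u (x, t))"
proof -
  have dom: "(x, t) + L s \<in> UNIV \<times> {0<..}" if "s \<in> {-e<..<e}" for s
  proof (cases "L s")
    case (Pair a b)
    then show ?thesis using e(2)[of s] that by auto
  qed
  have "smooth_on {-e<..<e} (\<lambda>s. u ((x, t) + L s))"
    using u dom by (intro smooth_on_affine_compose[OF _ open_spacetime L])
      (auto simp: harmonic_map_flow_def)
  moreover have "(\<lambda>s. u ((x, t) + L s)) ` {-e<..<e} \<subseteq> N"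
    using u dom unfolding harmonic_map_flow_def by blast
  moreover have "u ((x, t) + L 0) = u (x, t)"
    by (metis L add.right_neutral linear_simps(3))
  ultimately show ?thesis
    unfolding tangent_space_def using e(1) d
    by (intro CollectI exI[of _ "\<lambda>s. u ((x, t) + L s)"] exI[of _ e]) simp
qed

lemma partial_deriv_tangent:
  assumes "harmonic_map_flow N u" "0 < t"
  shows "partial_deriv i (\<lambda>y. u (y, t)) x \<in> tangent_space N (u (x, t))"
proof (rule velocity_tangent[OF assms(1), where L = "\<lambda>s. (s *\<^sub>R axis i 1, 0)" and e = 1])
  show "((\<lambda>s. u ((x, t) + (s *\<^sub>R axis i 1, 0))) has_vector_derivative
      partial_deriv i (\<lambda>y. u (y, t)) x) (at 0)"
    using partial_deriv_along_line[OF smooth_space_slice[OF assms], of x i 0] by simp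
qed (use assms(2) in \<open>auto intro!: bounded_linear_Pair bounded_linear_scaleR_left bounded_linear_zero\<close>)

lemma time_deriv_tangent:
  assumes "harmonic_map_flow N u" "0 < t"
  shows "time_deriv u x t \<in> tangent_space N (u (x, t))"
proof (rule velocity_tangent[OF assms(1), where L = "\<lambda>s. (0, s)" and e = t])
  have "((\<lambda>s. u (x, s)) \<circ> (\<lambda>s. t + s) has_vector_derivative 1 *\<^sub>R time_deriv u x t) (at 0)"
    using time_deriv_works[OF assms]
    by (intro vector_diff_chain_at) (auto intro!: derivative_eq_intros)
  then show "((\<lambda>s. u ((x, t) + (0, s))) has_vector_derivative time_deriv u x t) (at 0)"
    by (simp add: o_def)
qed (use assms(2) in \<open>auto intro!: bounded_linear_Pair bounded_linear_ident bounded_linear_zero\<close>)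

lemma second_partial_normal_bound:
  assumes g: "smooth_on UNIV g" "\<And>y. g y \<in> N"
    and C: "\<And>p. p \<in> N \<Longrightarrow> \<bar>(p - g x) \<bullet> \<nu>\<bar> \<le> B * (norm (p - g x))\<^sup>2"
  shows "- (partial_deriv i (partial_deriv i g) x \<bullet> \<nu>) \<le> 2 * B * (norm (partial_deriv i g x))\<^sup>2"
proof -
  let ?l = "\<lambda>s. x + s *\<^sub>R axis i 1"
  let ?g = "\<lambda>s. g (?l s) - g x" and ?g1 = "\<lambda>s. partial_deriv i g (?l s)"
    and ?g2 = "\<lambda>s. partial_deriv i (partial_deriv i g) (?l s)"
  let ?k = "\<lambda>s. - (?g s \<bullet> \<nu>) - B * (?g s \<bullet> ?g s)"
  let ?k1 = "\<lambda>s. - (?g1 s \<bullet> \<nu>) - B * (2 * (?g s \<bullet> ?g1 s))"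
  have dg: "(?g has_vector_derivative ?g1 s) (at s)" for s
    using has_vector_derivative_diff[OF partial_deriv_along_line[OF g(1)] has_vector_derivative_const]
    by simp
  have dg1: "(?g1 has_vector_derivative ?g2 s) (at s)" for s
    by (rule partial_deriv_along_line[OF smooth_on_partial_deriv[OF g(1)]])
  note inner_deriv = bounded_bilinear.has_vector_derivative[OF bounded_bilinear_inner]
  have "- (?g2 0 \<bullet> \<nu>) - B * (2 * (?g 0 \<bullet> ?g2 0 + ?g1 0 \<bullet> ?g1 0)) \<le> 0"
  proof (rule second_derivative_nonpos_at_max[of 1 ?k ?k1])
    show "(?k has_real_derivative ?k1 s) (at s)" for s
      unfolding has_real_derivative_iff_has_vector_derivative
      using inner_deriv[OF dg dg] inner_deriv[OF dg has_vector_derivative_const]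
      by (auto intro!: derivative_eq_intros simp: inner_commute)
    show "(?k1 has_real_derivative - (?g2 0 \<bullet> \<nu>) - B * (2 * (?g 0 \<bullet> ?g2 0 + ?g1 0 \<bullet> ?g1 0))) (at 0)"
      unfolding has_real_derivative_iff_has_vector_derivative
      using inner_deriv[OF dg dg1] inner_deriv[OF dg1 has_vector_derivative_const]
      by (auto intro!: derivative_eq_intros simp: inner_commute)
    show "?k s \<le> ?k 0" for s
      using C[OF g(2), of "?l s"] by (simp add: power2_norm_eq_inner)
  qed simp
  then show ?thesis by (simp add: power2_norm_eq_inner)
qed

lemma tension_normal:
  assumes N: "submanifold d N" and u: "harmonic_map_flow N u" and t: "0 < t"
  shows "time_deriv u x t - laplacian (\<lambda>y. u (y, t)) x \<in> (tangent_space N (u (x, t)))\<^sup>\<bottom>"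
proof -
  have "time_deriv u x t - laplacian (\<lambda>y. u (y, t)) x =
      (\<Sum>i\<in>UNIV. second_fundamental_form N (u (x, t))
         (partial_deriv i (\<lambda>y. u (y, t)) x) (partial_deriv i (\<lambda>y. u (y, t)) x))"
    using u t unfolding harmonic_map_flow_def by simp
  also have "\<dots> \<in> (tangent_space N (u (x, t)))\<^sup>\<bottom>"
    by (intro subspace_sum subspace_orthogonal_comp submanifold_second_fundamental_form_normal[OF N]
        harmonic_map_flow_in[OF u t] partial_deriv_tangent[OF u t])
  finally show ?thesis .
qed

lemma tension_bound:
  assumes N: "submanifold d N" and u: "harmonic_map_flow N u" and t: "0 < t" and C0: "0 < C"
    and C: "\<And>p q \<nu>. p \<in> N \<Longrightarrow> q \<in> N \<Longrightarrow> \<nu> \<in> (tangent_space N p)\<^sup>\<bottom>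
      \<Longrightarrow> \<bar>(q - p) \<bullet> \<nu>\<bar> \<le> C * norm \<nu> * (norm (q - p))\<^sup>2"
  shows "norm (time_deriv u x t - laplacian (\<lambda>y. u (y, t)) x)
    \<le> 2 * C * (norm_nabla 1 (\<lambda>y. u (y, t)) x)\<^sup>2"
proof -
  let ?g = "\<lambda>y. u (y, t)"
  define \<nu> where "\<nu> = time_deriv u x t - laplacian ?g x"
  have \<nu>: "\<nu> \<in> (tangent_space N (u (x, t)))\<^sup>\<bottom>"
    unfolding \<nu>_def by (rule tension_normal[OF N u t])
  have "time_deriv u x t \<bullet> \<nu> = 0"
    using \<nu> time_deriv_tangent[OF u t] by (auto simp: orthogonal_comp_def orthogonal_def)
  then have "(norm \<nu>)\<^sup>2 = (\<Sum>i\<in>UNIV. - (partial_deriv i (partial_deriv i ?g) x \<bullet> \<nu>))"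
    unfolding power2_norm_eq_inner
    by (subst \<nu>_def) (simp add: inner_diff_left laplacian_def inner_sum_left sum_negf)
  also have "\<dots> \<le> (\<Sum>i\<in>UNIV. 2 * (C * norm \<nu>) * (norm (partial_deriv i ?g x))\<^sup>2)"
  proof (intro sum_mono second_partial_normal_bound)
    show "smooth_on UNIV ?g" by (rule smooth_space_slice[OF u t])
    show "u (y, t) \<in> N" for y by (rule harmonic_map_flow_in[OF u t])
    then show "\<bar>(p - u (x, t)) \<bullet> \<nu>\<bar> \<le> C * norm \<nu> * (norm (p - u (x, t)))\<^sup>2" if "p \<in> N" for p
      using C \<nu> that by blast
  qed
  also have "\<dots> = norm \<nu> * (2 * C * (norm_nabla 1 ?g x)\<^sup>2)"
    by (simp add: norm_nabla_1_squared sum_distrib_left mult_ac del: One_nat_def)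
  finally have "norm \<nu> * norm \<nu> \<le> norm \<nu> * (2 * C * (norm_nabla 1 ?g x)\<^sup>2)"
    by (simp add: power2_eq_square)
  then have "norm \<nu> \<le> 2 * C * (norm_nabla 1 ?g x)\<^sup>2"
    using C0 by (cases "\<nu> = 0") (auto simp del: One_nat_def)
  then show ?thesis unfolding \<nu>_def .
qed

lemma heat_inequality:
  assumes N: "submanifold d N" and u: "harmonic_map_flow N u1" "harmonic_map_flow N u2" and t: "0 < t"
    and x: "x \<noteq> 0" and C0: "0 < C"
    and C: "\<And>p q \<nu>. p \<in> N \<Longrightarrow> q \<in> N \<Longrightarrow> \<nu> \<in> (tangent_space N p)\<^sup>\<bottom>
      \<Longrightarrow> \<bar>(q - p) \<bullet> \<nu>\<bar> \<le> C * norm \<nu> * (norm (q - p))\<^sup>2"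
    and c: "scaled_gradient_bound u1 c" "scaled_gradient_bound u2 c"
  shows "((time_deriv u1 x t - time_deriv u2 x t) -
      (laplacian (\<lambda>y. u1 (y, t)) x - laplacian (\<lambda>y. u2 (y, t)) x)) \<bullet> (u1 (x, t) - u2 (x, t))
    \<le> 4 * C\<^sup>2 * c / (norm x)\<^sup>2 * (norm (u1 (x, t) - u2 (x, t)))\<^sup>2"
proof -
  define \<nu> where "\<nu> u = time_deriv u x t - laplacian (\<lambda>y. u (y, t)) x" for u :: "(real^'b) \<times> real \<Rightarrow> real^'a"
  let ?w = "u1 (x, t) - u2 (x, t)"
  have grad: "(norm_nabla 1 (\<lambda>y. u (y, t)) x)\<^sup>2 \<le> c / (norm x)\<^sup>2"
    if "scaled_gradient_bound u c" for u :: "(real^'b) \<times> real \<Rightarrow> real^'a"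
  proof -
    have "(norm x)\<^sup>2 * (norm_nabla 1 (\<lambda>y. u (y, t)) x)\<^sup>2
        \<le> ((norm x)\<^sup>2 + t) * (norm_nabla 1 (\<lambda>y. u (y, t)) x)\<^sup>2"
      using t by (intro mult_right_mono) auto
    also have "\<dots> \<le> c" using that t unfolding scaled_gradient_bound_def by blast
    finally show ?thesis using x by (simp add: field_simps)
  qed
  have est: "\<bar>(q - u (x, t)) \<bullet> \<nu> u\<bar> \<le> 2 * C\<^sup>2 * c / (norm x)\<^sup>2 * (norm (q - u (x, t)))\<^sup>2"
    if "harmonic_map_flow N u" "scaled_gradient_bound u c" "q \<in> N" for u q
  proof -
    have "\<nu> u \<in> (tangent_space N (u (x, t)))\<^sup>\<bottom>"
      unfolding \<nu>_def by (rule tension_normal[OF N that(1) t])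
    then have "\<bar>(q - u (x, t)) \<bullet> \<nu> u\<bar> \<le> C * norm (\<nu> u) * (norm (q - u (x, t)))\<^sup>2"
      by (intro C harmonic_map_flow_in[OF that(1) t] that(3))
    also have "\<dots> \<le> C * (2 * C * (c / (norm x)\<^sup>2)) * (norm (q - u (x, t)))\<^sup>2"
    proof (intro mult_right_mono mult_left_mono)
      have "norm (\<nu> u) \<le> 2 * C * (norm_nabla 1 (\<lambda>y. u (y, t)) x)\<^sup>2"
        unfolding \<nu>_def by (rule tension_bound[OF N that(1) t C0 C])
      also have "\<dots> \<le> 2 * C * (c / (norm x)\<^sup>2)"
        using grad[OF that(2)] C0 by (intro mult_left_mono) auto
      finally show "norm (\<nu> u) \<le> 2 * C * (c / (norm x)\<^sup>2)" .
    qed (use C0 in auto)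
    finally show ?thesis by (simp add: power2_eq_square mult_ac)
  qed
  have "\<nu> u1 \<bullet> ?w = - ((u2 (x, t) - u1 (x, t)) \<bullet> \<nu> u1)" "\<nu> u2 \<bullet> ?w = (u1 (x, t) - u2 (x, t)) \<bullet> \<nu> u2"
    by (simp_all add: inner_diff_left inner_diff_right inner_commute)
  then have "\<nu> u1 \<bullet> ?w - \<nu> u2 \<bullet> ?w \<le> 2 * (2 * C\<^sup>2 * c / (norm x)\<^sup>2 * (norm ?w)\<^sup>2)"
    using est[OF u(1) c(1) harmonic_map_flow_in[OF u(2) t, of x]]
      est[OF u(2) c(2) harmonic_map_flow_in[OF u(1) t, of x]]
    by (simp add: norm_minus_commute)
  moreover have "(time_deriv u1 x t - time_deriv u2 x t) -
      (laplacian (\<lambda>y. u1 (y, t)) x - laplacian (\<lambda>y. u2 (y, t)) x) = \<nu> u1 - \<nu> u2"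
    by (simp add: \<nu>_def)
  ultimately show ?thesis by (simp add: inner_diff_left)
qed

lemma space_lipschitz:
  fixes u :: "(real^'n) \<times> real \<Rightarrow> real^'m"
  assumes u: "harmonic_map_flow N u" "scaled_gradient_bound u c" "0 < t"
    and \<rho>: "0 < \<rho>" "\<rho> \<le> norm x" "norm (y - x) \<le> \<rho> / 2"
  shows "norm (u (y, t) - u (x, t)) \<le> real CARD('n) * (2 * sqrt c / \<rho>) * norm (y - x)"
proof (rule differentiable_bound[where S = "cball x (\<rho> / 2)"])
  fix z assume z: "z \<in> cball x (\<rho> / 2)"
  let ?g = "\<lambda>y. u (y, t)"
  have "C_k_on (Suc 0) UNIV ?g"
    using smooth_space_slice[OF u(1,3)] by (simp add: smooth_on_def del: C_k_on.simps)
  then have diff: "?g differentiable at z" by simp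
  then show "(?g has_derivative frechet_derivative ?g (at z)) (at z within cball x (\<rho> / 2))"
    using frechet_derivative_works has_derivative_at_withinI by blast
  have "norm x \<le> norm z + norm (x - z)" using norm_triangle_sub[of x z] by simp
  then have nz: "\<rho> / 2 \<le> norm z" using z \<rho> by (simp add: dist_norm)
  have "(\<rho> / 2)\<^sup>2 * (norm_nabla 1 ?g z)\<^sup>2 \<le> ((norm z)\<^sup>2 + t) * (norm_nabla 1 ?g z)\<^sup>2"
    using power_mono[OF nz, of 2] u(3) \<rho>(1) by (intro mult_right_mono add_increasing2) auto
  also have "\<dots> \<le> c" using u unfolding scaled_gradient_bound_def by blast
  finally have "(\<rho> / 2 * norm_nabla 1 ?g z)\<^sup>2 \<le> c" by (simp only: power_mult_distrib)
  then have "\<rho> / 2 * norm_nabla 1 ?g z \<le> sqrt c" by (rule real_le_rsqrt)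
  then have B: "norm_nabla 1 ?g z \<le> 2 * sqrt c / \<rho>" using \<rho>(1) by (simp add: field_simps)
  moreover have "0 \<le> norm_nabla 1 ?g z" by (simp add: norm_nabla_def sum_nonneg)
  ultimately have "0 \<le> 2 * sqrt c / \<rho>" by linarith
  then show "onorm (frechet_derivative ?g (at z)) \<le> real CARD('n) * (2 * sqrt c / \<rho>)"
    by (intro onorm_bound order_trans[OF norm_frechet_le_norm_nabla[OF diff]]
        mult_right_mono mult_left_mono B mult_nonneg_nonneg) auto
qed (use \<rho> in \<open>auto simp: dist_norm norm_minus_commute\<close>)

section \<open>The barrier\<close>

definition profile :: "real \<Rightarrow> real \<Rightarrow> real \<Rightarrow> real" where
  "profile b a s = s powr (-b) * exp (-s) * (1 - a / s)"

definition profile1 :: "real \<Rightarrow> real \<Rightarrow> real \<Rightarrow> real" where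
  "profile1 b a s = s powr (-b) * exp (-s) * ((- b / s - 1) * (1 - a / s) + a / s\<^sup>2)"

definition profile2 :: "real \<Rightarrow> real \<Rightarrow> real \<Rightarrow> real" where
  "profile2 b a s = s powr (-b) * exp (-s) *
     ((- b / s - 1) * ((- b / s - 1) * (1 - a / s) + a / s\<^sup>2) +
      (b / s\<^sup>2 * (1 - a / s) + (- b / s - 1) * (a / s\<^sup>2) - 2 * a / s ^ 3))"

lemma weight_has_derivative:
  assumes "0 < (s::real)"
  shows "((\<lambda>s. s powr (-b) * exp (-s)) has_real_derivative
    s powr (-b) * exp (-s) * (- b / s - 1)) (at s)"
proof -
  have "s powr (- b - 1) = s powr (-b) / s"
    using assms by (simp add: powr_diff)
  then show ?thesis using assms
    by (auto intro!: derivative_eq_intros simp: algebra_simps)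
qed

lemma profile_has_derivative:
  assumes "0 < s"
  shows "(profile b a has_real_derivative profile1 b a s) (at s)"
proof -
  have "((\<lambda>s. 1 - a / s) has_real_derivative a / s\<^sup>2) (at s)"
    using assms by (auto intro!: derivative_eq_intros simp: power2_eq_square)
  from DERIV_mult[OF weight_has_derivative[OF assms, of b] this]
  show ?thesis
    unfolding profile_def[abs_def] profile1_def
    by (rule DERIV_cong) (simp only: distrib_left mult.assoc mult.commute[of "a / s\<^sup>2"])
qed

lemma profile1_has_derivative:
  assumes "0 < s"
  shows "(profile1 b a has_real_derivative profile2 b a s) (at s)"
proof -
  have "((\<lambda>s. (- b / s - 1) * (1 - a / s) + a / s\<^sup>2) has_real_derivative
      (b / s\<^sup>2 * (1 - a / s) + (- b / s - 1) * (a / s\<^sup>2) - 2 * a / s ^ 3)) (at s)"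
    using assms by (auto intro!: derivative_eq_intros simp: power2_eq_square power3_eq_cube field_simps)
  note d = DERIV_mult[OF weight_has_derivative[OF assms, of b] this]
  have product: "E * q * p + p' * E = E * (q * p + p')" for E q p p' :: real
    by (simp add: algebra_simps)
  show ?thesis
    unfolding profile1_def[abs_def] profile2_def by (rule DERIV_cong[OF d product])
qed

lemma profile_supersolution:
  assumes "0 < s" "0 \<le> b" "0 \<le> K" "b + K / 4 \<le> a"
  shows "s * profile2 b a s + (s + b) * profile1 b a s + K / (4 * s) * profile b a s \<le> 0"
proof -
  define E where "E = s powr (-b) * exp (-s)"
  define p where "p = (- b / s - 1) * (1 - a / s) + a / s\<^sup>2"
  define p' where "p' = b / s\<^sup>2 * (1 - a / s) + (- b / s - 1) * (a / s\<^sup>2) - 2 * a / s ^ 3"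
  have E: "0 < E" using assms by (simp add: E_def)
  have a: "0 \<le> a" using assms by simp
  have sp: "s * ((- b / s - 1) * p) = - (s + b) * p" using assms(1) by (simp add: field_simps)
  have "s * profile2 b a s + (s + b) * profile1 b a s + K / (4 * s) * profile b a s
      = E * (s * ((- b / s - 1) * p) + s * p' + (s + b) * p + K / (4 * s) * (1 - a / s))"
    unfolding profile_def profile1_def profile2_def E_def[symmetric] p_def[symmetric] p'_def[symmetric]
    by (simp add: algebra_simps)
  also have "\<dots> = E * (s * p' + K / (4 * s) * (1 - a / s))" unfolding sp by (simp add: algebra_simps)
  also have "s * p' + K / (4 * s) * (1 - a / s)
      = ((b + K / 4 - a) - (b + K / 4) * (a / s) - a * b / s - 2 * a / s) / s"
    using assms(1) by (simp add: p'_def field_simps power2_eq_square power3_eq_cube)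
  finally have *: "s * profile2 b a s + (s + b) * profile1 b a s + K / (4 * s) * profile b a s
    = E * (((b + K / 4 - a) - (b + K / 4) * (a / s) - a * b / s - 2 * a / s) / s)" .
  have "0 \<le> (b + K / 4) * (a / s)" "0 \<le> a * b / s" "0 \<le> 2 * a / s" using assms a by auto
  then have "(b + K / 4 - a) - (b + K / 4) * (a / s) - a * b / s - 2 * a / s \<le> 0"
    using assms(4) by linarith
  then show ?thesis unfolding * using E assms(1)
    by (intro mult_nonneg_nonpos divide_nonpos_pos) auto
qed

definition barrier :: "real \<Rightarrow> real \<Rightarrow> real \<Rightarrow> real \<Rightarrow> real \<Rightarrow> real \<Rightarrow> real \<Rightarrow> real" where
  "barrier b a A M \<epsilon> r t = A * profile b a (r / (4 * t)) + \<epsilon> * (1 / r + M * t / r\<^sup>2 + r + M * t)"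

definition barrier_r :: "real \<Rightarrow> real \<Rightarrow> real \<Rightarrow> real \<Rightarrow> real \<Rightarrow> real \<Rightarrow> real \<Rightarrow> real" where
  "barrier_r b a A M \<epsilon> r t = A * (profile1 b a (r / (4 * t)) / (4 * t))
     + \<epsilon> * (- 1 / r\<^sup>2 - 2 * M * t / r ^ 3 + 1)"

definition barrier_rr :: "real \<Rightarrow> real \<Rightarrow> real \<Rightarrow> real \<Rightarrow> real \<Rightarrow> real \<Rightarrow> real \<Rightarrow> real" where
  "barrier_rr b a A M \<epsilon> r t = A * (profile2 b a (r / (4 * t)) / (16 * t\<^sup>2))
     + \<epsilon> * (2 / r ^ 3 + 6 * M * t / r ^ 4)"

definition barrier_t :: "real \<Rightarrow> real \<Rightarrow> real \<Rightarrow> real \<Rightarrow> real \<Rightarrow> real \<Rightarrow> real \<Rightarrow> real" where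
  "barrier_t b a A M \<epsilon> r t = - A * (profile1 b a (r / (4 * t)) * r / (4 * t\<^sup>2))
     + \<epsilon> * (M / r\<^sup>2 + M)"

lemma barrier_has_derivative_r:
  assumes "0 < r" "0 < t"
  shows "((\<lambda>r. barrier b a A M \<epsilon> r t) has_real_derivative barrier_r b a A M \<epsilon> r t) (at r)"
proof -
  have "((\<lambda>r. profile b a (r / (4 * t))) has_real_derivative profile1 b a (r / (4 * t)) * (1 / (4 * t))) (at r)"
    using assms by (intro DERIV_chain2[OF profile_has_derivative]) (auto intro!: derivative_eq_intros)
  then have 1: "((\<lambda>r. profile b a (r / (4 * t))) has_real_derivative profile1 b a (r / (4 * t)) / (4 * t)) (at r)"
    by simp
  have 2: "((\<lambda>r. 1 / r + M * t / r\<^sup>2 + r + M * t) has_real_derivative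
      - 1 / r\<^sup>2 - 2 * M * t / r ^ 3 + 1) (at r)"
    using assms by (auto intro!: derivative_eq_intros simp: field_simps eval_nat_numeral)
  show ?thesis
    unfolding barrier_def barrier_r_def by (rule DERIV_add[OF DERIV_cmult[OF 1] DERIV_cmult[OF 2]])
qed

lemma barrier_has_derivative_rr:
  assumes "0 < r" "0 < t"
  shows "((\<lambda>r. barrier_r b a A M \<epsilon> r t) has_real_derivative barrier_rr b a A M \<epsilon> r t) (at r)"
proof -
  have "((\<lambda>r. profile1 b a (r / (4 * t))) has_real_derivative profile2 b a (r / (4 * t)) * (1 / (4 * t))) (at r)"
    using assms by (intro DERIV_chain2[OF profile1_has_derivative]) (auto intro!: derivative_eq_intros)
  then have 1: "((\<lambda>r. profile1 b a (r / (4 * t)) / (4 * t)) has_real_derivative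
      profile2 b a (r / (4 * t)) / (16 * t\<^sup>2)) (at r)"
    by (rule DERIV_cdivide[THEN DERIV_cong]) (simp add: power2_eq_square)
  have 2: "((\<lambda>r. - 1 / r\<^sup>2 - 2 * M * t / r ^ 3 + 1) has_real_derivative
      2 / r ^ 3 + 6 * M * t / r ^ 4) (at r)"
    using assms by (auto intro!: derivative_eq_intros simp: field_simps eval_nat_numeral)
  show ?thesis
    unfolding barrier_r_def barrier_rr_def by (rule DERIV_add[OF DERIV_cmult[OF 1] DERIV_cmult[OF 2]])
qed

lemma barrier_has_derivative_t:
  assumes "0 < r" "0 < t"
  shows "((\<lambda>t. barrier b a A M \<epsilon> r t) has_real_derivative barrier_t b a A M \<epsilon> r t) (at t)"
proof -
  have 1: "((\<lambda>t. profile b a (r / (4 * t))) has_real_derivative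
      profile1 b a (r / (4 * t)) * (- r / (4 * t\<^sup>2))) (at t)"
    using assms by (intro DERIV_chain2[OF profile_has_derivative])
      (auto intro!: derivative_eq_intros simp: power2_eq_square)
  have 2: "((\<lambda>t. 1 / r + M * t / r\<^sup>2 + r + M * t) has_real_derivative M / r\<^sup>2 + M) (at t)"
    using assms by (auto intro!: derivative_eq_intros simp: field_simps eval_nat_numeral)
  have "((\<lambda>t. barrier b a A M \<epsilon> r t) has_real_derivative
      A * (profile1 b a (r / (4 * t)) * (- r / (4 * t\<^sup>2))) + \<epsilon> * (M / r\<^sup>2 + M)) (at t)"
    unfolding barrier_def by (rule DERIV_add[OF DERIV_cmult[OF 1] DERIV_cmult[OF 2]])
  then show ?thesis by (simp add: barrier_t_def)
qed

lemma barrier_strict_supersolution: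
  assumes r: "0 < r" and t: "0 < t" and s: "4 * (24 + K) * t \<le> r"
    and n: "0 \<le> n" and K: "0 \<le> K" and a: "n / 2 + K / 4 \<le> a"
    and A: "0 \<le> A" and \<epsilon>: "0 < \<epsilon>" and M: "M = 4 * (n + K + 8)"
  shows "K / r * barrier (n / 2) a A M \<epsilon> r t <
    barrier_t (n / 2) a A M \<epsilon> r t - 4 * r * barrier_rr (n / 2) a A M \<epsilon> r t
      - 2 * n * barrier_r (n / 2) a A M \<epsilon> r t"
proof -
  define s' where "s' = r / (4 * t)"
  define \<tau> where "\<tau> = t / r"
  let ?S = "s' * profile2 (n / 2) a s' + (s' + n / 2) * profile1 (n / 2) a s' + K / (4 * s') * profile (n / 2) a s'"
  have s'0: "0 < s'" and r_eq: "r = 4 * s' * t" using r t by (simp_all add: s'_def)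
  have S: "?S \<le> 0" by (rule profile_supersolution) (use s'0 n K a in auto)
  have \<tau>: "0 < \<tau>" "4 * ((24 + K) * \<tau>) \<le> 1" using r t s by (simp_all add: \<tau>_def field_simps)
  have M0: "0 < M" using M n K by simp
  have 1: "(24 + K) * \<tau> * M \<le> M / 4" using mult_right_mono[OF \<tau>(2), of M] M0 by simp
  have "0 \<le> 24 * \<tau> * M" using \<tau>(1) M0 by simp
  then have 2: "K * \<tau> * M \<le> M / 4" using 1 by (simp add: algebra_simps)
  have "0 \<le> 4 * n * \<tau> * M" using \<tau>(1) M0 n by simp
  then have pos1: "0 < M - 8 + 2 * n - K + (4 * n - 24 - K) * M * \<tau>"
    using 1 M n K by (simp add: algebra_simps)
  have pos2: "0 < M - 2 * n - K - K * M * \<tau>" using 2 M n K by (simp add: algebra_simps)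
  have e: "M / r\<^sup>2 + M - 4 * r * (2 / r ^ 3 + 6 * M * t / r ^ 4)
      - 2 * n * (- 1 / r\<^sup>2 - 2 * M * t / r ^ 3 + 1) - K / r * (1 / r + M * t / r\<^sup>2 + r + M * t)
    = (M - 8 + 2 * n - K + (4 * n - 24 - K) * M * \<tau>) / r\<^sup>2 + (M - 2 * n - K - K * M * \<tau>)"
    using r by (simp add: \<tau>_def field_simps eval_nat_numeral)
  have e0: "0 < (M - 8 + 2 * n - K + (4 * n - 24 - K) * M * \<tau>) / r\<^sup>2 + (M - 2 * n - K - K * M * \<tau>)"
    using pos1 pos2 r by (simp add: add_pos_pos)
  have p: "- (profile1 (n / 2) a s' * r / (4 * t\<^sup>2)) - 4 * r * (profile2 (n / 2) a s' / (16 * t\<^sup>2))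
      - 2 * n * (profile1 (n / 2) a s' / (4 * t)) - K / r * profile (n / 2) a s' = - ?S / t"
    unfolding r_eq using t s'0 by (simp add: field_simps power2_eq_square)
  have "barrier_t (n / 2) a A M \<epsilon> r t - 4 * r * barrier_rr (n / 2) a A M \<epsilon> r t
      - 2 * n * barrier_r (n / 2) a A M \<epsilon> r t - K / r * barrier (n / 2) a A M \<epsilon> r t
    = A * (- ?S / t) + \<epsilon> * ((M - 8 + 2 * n - K + (4 * n - 24 - K) * M * \<tau>) / r\<^sup>2
        + (M - 2 * n - K - K * M * \<tau>))"
    unfolding p[symmetric] e[symmetric] barrier_t_def barrier_r_def barrier_rr_def barrier_def s'_def[symmetric]
    by algebra
  moreover have "0 \<le> A * (- ?S / t)" using A S t by (intro mult_nonneg_nonneg divide_nonneg_pos) auto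
  ultimately show ?thesis using mult_pos_pos[OF \<epsilon> e0] by linarith
qed

lemma barrier_ge_profile:
  assumes "0 < r" "0 < t" "0 \<le> \<epsilon>" "0 \<le> M"
  shows "A * profile b a (r / (4 * t)) \<le> barrier b a A M \<epsilon> r t"
  using assms by (simp add: barrier_def add_nonneg_nonneg)

lemma barrier_ge_error:
  assumes "0 < r" "0 < t" "0 \<le> \<epsilon>" "0 \<le> M" "0 \<le> A" "a \<le> r / (4 * t)"
  shows "\<epsilon> / r \<le> barrier b a A M \<epsilon> r t" "\<epsilon> * r \<le> barrier b a A M \<epsilon> r t"
proof -
  have "a / (r / (4 * t)) \<le> 1"
    using assms by (subst divide_le_eq_1) auto
  then have "0 \<le> A * profile b a (r / (4 * t))"
    using assms unfolding profile_def by (intro mult_nonneg_nonneg) auto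
  moreover have "0 \<le> \<epsilon> / r" "0 \<le> \<epsilon> * r" "0 \<le> \<epsilon> * (M * t / r\<^sup>2)" "0 \<le> \<epsilon> * (M * t)"
    using assms by simp_all
  moreover have "barrier b a A M \<epsilon> r t
      = A * profile b a (r / (4 * t)) + \<epsilon> / r + \<epsilon> * (M * t / r\<^sup>2) + \<epsilon> * r + \<epsilon> * (M * t)"
    by (simp add: barrier_def algebra_simps)
  ultimately show "\<epsilon> / r \<le> barrier b a A M \<epsilon> r t" "\<epsilon> * r \<le> barrier b a A M \<epsilon> r t"
    by linarith+
qed

section \<open>Comparison\<close>

lemma laplacian_le_at_spatial_max:
  fixes g :: "real^'n \<Rightarrow> 'b::euclidean_space"
  assumes g: "smooth_on UNIV g" and "0 < d" and x: "x \<noteq> 0"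
    and F1: "\<And>r. 0 < r \<Longrightarrow> (F has_real_derivative F1 r) (at r)"
    and F2: "(F1 has_real_derivative F2) (at ((norm x)\<^sup>2))"
    and le: "\<And>y. norm (y - x) < d \<Longrightarrow> y \<noteq> 0 \<Longrightarrow> g y \<bullet> e \<le> F ((norm y)\<^sup>2)"
    and eq: "g x \<bullet> e = F ((norm x)\<^sup>2)"
  shows "laplacian g x \<bullet> e \<le> 4 * (norm x)\<^sup>2 * F2 + 2 * real CARD('n) * F1 ((norm x)\<^sup>2)"
proof -
  have "partial_deriv i (partial_deriv i g) x \<bullet> e \<le> 4 * (x $ i)\<^sup>2 * F2 + 2 * F1 ((norm x)\<^sup>2)" for i
  proof -
    let ?l = "\<lambda>s. x + s *\<^sub>R axis i 1" and ?r = "\<lambda>s. (norm x)\<^sup>2 + 2 * s * x $ i + s\<^sup>2"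
    let ?k = "\<lambda>s. g (?l s) \<bullet> e - F (?r s)"
    let ?k1 = "\<lambda>s. partial_deriv i g (?l s) \<bullet> e - F1 (?r s) * (2 * x $ i + 2 * s)"
    let ?k2 = "partial_deriv i (partial_deriv i g) x \<bullet> e - (4 * (x $ i)\<^sup>2 * F2 + 2 * F1 ((norm x)\<^sup>2))"
    define \<delta> where "\<delta> = min d (norm x)"
    have \<delta>: "0 < \<delta>" "\<delta> \<le> d" "\<delta> \<le> norm x" using \<open>0 < d\<close> x by (auto simp: \<delta>_def)
    have r: "(norm (?l s))\<^sup>2 = ?r s" for s
      unfolding power2_norm_eq_inner
      by (simp add: inner_add_left inner_add_right inner_axis inner_axis' algebra_simps power2_eq_square)
    have nz: "?l s \<noteq> 0" if "\<bar>s\<bar> < \<delta>" for s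
    proof
      assume "?l s = 0"
      then have "norm x = \<bar>s\<bar>" by (metis add_eq_0_iff norm_minus_cancel norm_scaleR norm_axis_1 mult.right_neutral)
      then show False using that \<delta> by simp
    qed
    have rpos: "0 < ?r s" if "\<bar>s\<bar> < \<delta>" for s
      using nz[OF that] by (metis r zero_less_norm_iff zero_less_power)
    have dr: "(?r has_real_derivative 2 * x $ i + 2 * s) (at s)" for s
      by (auto intro!: derivative_eq_intros)
    have dg: "((\<lambda>s. h (?l s) \<bullet> e) has_real_derivative partial_deriv i h (?l s) \<bullet> e) (at s)"
      if "smooth_on UNIV h" for h s
      unfolding has_real_derivative_iff_has_vector_derivative
      by (rule bounded_linear.has_vector_derivative[OF bounded_linear_inner_left partial_deriv_along_line[OF that]])
    have "?k2 \<le> 0"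
    proof (rule second_derivative_nonpos_at_max[OF \<delta>(1), of ?k ?k1])
      fix s :: real assume s: "\<bar>s\<bar> < \<delta>"
      show "(?k has_real_derivative ?k1 s) (at s)"
        by (rule DERIV_diff[OF dg[OF g] DERIV_chain2[OF F1[OF rpos[OF s]] dr]])
      have "norm (?l s - x) < d" using s \<delta> by simp
      then show "?k s \<le> ?k 0"
        using le[OF _ nz[OF s]] eq by (simp add: r)
    next
      have "(F1 has_real_derivative F2) (at (?r 0))" using F2 by simp
      then have "((\<lambda>s. F1 (?r s)) has_real_derivative F2 * (2 * x $ i + 2 * 0)) (at 0)"
        using dr by (rule DERIV_chain2)
      moreover have "((\<lambda>s. 2 * x $ i + 2 * s) has_real_derivative 2) (at 0)"
        by (auto intro!: derivative_eq_intros)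
      ultimately have d: "((\<lambda>s. F1 (?r s) * (2 * x $ i + 2 * s)) has_real_derivative
          F2 * (2 * x $ i + 2 * 0) * (2 * x $ i + 2 * 0) + 2 * F1 (?r 0)) (at 0)"
        by (rule DERIV_mult)
      have "(?k1 has_real_derivative partial_deriv i (partial_deriv i g) (?l 0) \<bullet> e
          - (F2 * (2 * x $ i + 2 * 0) * (2 * x $ i + 2 * 0) + 2 * F1 (?r 0))) (at 0)"
        by (rule DERIV_diff[OF dg[OF smooth_on_partial_deriv[OF g]] d])
      then show "(?k1 has_real_derivative ?k2) (at 0)"
        by (rule DERIV_cong) (simp add: power2_eq_square)
    qed
    then show ?thesis by simp
  qed
  then have "laplacian g x \<bullet> e \<le> (\<Sum>i\<in>(UNIV :: 'n set). 4 * (x $ i)\<^sup>2 * F2 + 2 * F1 ((norm x)\<^sup>2))"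
    unfolding laplacian_def inner_sum_left by (intro sum_mono)
  also have "\<dots> = 4 * (\<Sum>i\<in>UNIV. (x $ i)\<^sup>2) * F2 + 2 * real CARD('n) * F1 ((norm x)\<^sup>2)"
    by (simp add: sum.distrib sum_distrib_left sum_distrib_right mult_ac)
  also have "(\<Sum>i\<in>UNIV. (x $ i)\<^sup>2) = (norm x)\<^sup>2"
    unfolding power2_norm_eq_inner by (simp add: inner_vec_def power2_eq_square)
  finally show ?thesis .
qed

text \<open>Testing against the fixed unit vector \<open>e = w(x,t) / |w(x,t)|\<close> makes the comparison at a
  maximum of \<open>|w| / (m \<Phi>)\<close> linear in \<open>w = u1 - u2\<close>, so no inequality for \<open>|w|\<close> off that
  point is needed.\<close>

lemma no_interior_touching:
  fixes u1 u2 :: "(real^'n) \<times> real \<Rightarrow> real^'m"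
  assumes u: "harmonic_map_flow N u1" "harmonic_map_flow N u2"
    and S: "open S" "(x, t) \<in> S" "S \<subseteq> {(x, t). x \<noteq> 0 \<and> 0 < t}"
    and ineq: "((time_deriv u1 x t - time_deriv u2 x t) -
        (laplacian (\<lambda>y. u1 (y, t)) x - laplacian (\<lambda>y. u2 (y, t)) x)) \<bullet> (u1 (x, t) - u2 (x, t))
      \<le> K / (norm x)\<^sup>2 * (norm (u1 (x, t) - u2 (x, t)))\<^sup>2"
    and d1: "\<And>r. 0 < r \<Longrightarrow> ((\<lambda>r. \<Phi> r t) has_real_derivative \<Phi>1 r) (at r)"
    and d2: "(\<Phi>1 has_real_derivative \<Phi>2) (at ((norm x)\<^sup>2))"
    and d3: "((\<lambda>t. \<Phi> ((norm x)\<^sup>2) t) has_real_derivative \<Phi>3) (at t)"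
    and strict: "K / (norm x)\<^sup>2 * \<Phi> ((norm x)\<^sup>2) t
      < \<Phi>3 - 4 * (norm x)\<^sup>2 * \<Phi>2 - 2 * real CARD('n) * \<Phi>1 ((norm x)\<^sup>2)"
    and m: "0 < m" "0 < \<Phi> ((norm x)\<^sup>2) t"
    and le: "\<And>y s. (y, s) \<in> S \<Longrightarrow> norm (u1 (y, s) - u2 (y, s)) \<le> m * \<Phi> ((norm y)\<^sup>2) s"
    and eq: "norm (u1 (x, t) - u2 (x, t)) = m * \<Phi> ((norm x)\<^sup>2) t"
  shows False
proof -
  have xt: "x \<noteq> 0" "0 < t" using S by auto
  let ?w = "\<lambda>y s. u1 (y, s) - u2 (y, s)"
  define W where "W = norm (?w x t)"
  have W: "0 < W" using eq m by (simp add: W_def)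
  define e where "e = ?w x t /\<^sub>R W"
  have ne: "norm e = 1" using W by (simp add: e_def W_def)
  have we: "v \<bullet> ?w x t = W * (v \<bullet> e)" for v using W by (simp add: e_def)
  have wle: "?w y s \<bullet> e \<le> m * \<Phi> ((norm y)\<^sup>2) s" if "(y, s) \<in> S" for y s
  proof -
    have "?w y s \<bullet> e \<le> norm (?w y s)" using norm_cauchy_schwarz[of "?w y s" e] ne by simp
    then show ?thesis using le[OF that] by linarith
  qed
  have weq: "?w x t \<bullet> e = m * \<Phi> ((norm x)\<^sup>2) t"
  proof -
    have "W * (?w x t \<bullet> e) = W * W"
      unfolding we[symmetric] by (simp add: W_def dot_square_norm power2_eq_square)
    then have "?w x t \<bullet> e = W" using W by simp
    then show ?thesis using eq by (simp add: W_def)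
  qed
  obtain d where d: "0 < d" "ball (x, t) d \<subseteq> S" using S open_contains_ball by blast
  have space: "(y, t) \<in> S" if "norm (y - x) < d" for y
    using that d(2) by (force simp: dist_Pair_Pair dist_norm norm_minus_commute)
  have time: "(x, s) \<in> S" if "\<bar>t - s\<bar> < d" for s
    using that d(2) by (force simp: dist_Pair_Pair dist_norm)
  have smooth: "smooth_on UNIV (\<lambda>y. ?w y t)"
    using smooth_space_slice[OF u(1) xt(2)] smooth_space_slice[OF u(2) xt(2)]
      C_k_on_add[OF open_UNIV _ C_k_on_bounded_linear[OF open_UNIV bounded_linear_minus[OF bounded_linear_ident]]]
    unfolding smooth_on_def by fastforce
  have pd: "partial_deriv i (\<lambda>y. f y - g y) = (\<lambda>y. partial_deriv i f y - partial_deriv i g y)"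
    if "smooth_on UNIV f" "smooth_on UNIV g" for i and f g :: "real^'n \<Rightarrow> real^'m"
  proof
    fix y
    have "(f has_derivative frechet_derivative f (at y)) (at y)"
      "(g has_derivative frechet_derivative g (at y)) (at y)"
      using that unfolding smooth_on_def by (blast intro: C_k_on_has_derivative)+
    from frechet_derivative_at[OF has_derivative_diff[OF this]]
    show "partial_deriv i (\<lambda>y. f y - g y) y = partial_deriv i f y - partial_deriv i g y"
      unfolding partial_deriv_def by metis
  qed
  have lap: "laplacian (\<lambda>y. ?w y t) x = laplacian (\<lambda>y. u1 (y, t)) x - laplacian (\<lambda>y. u2 (y, t)) x"
    using smooth_space_slice[OF u(1) xt(2)] smooth_space_slice[OF u(2) xt(2)]
    by (simp add: laplacian_def pd smooth_on_partial_deriv sum_subtractf)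
  have "laplacian (\<lambda>y. ?w y t) x \<bullet> e
      \<le> 4 * (norm x)\<^sup>2 * (m * \<Phi>2) + 2 * real CARD('n) * (m * \<Phi>1 ((norm x)\<^sup>2))"
    by (rule laplacian_le_at_spatial_max[OF smooth d(1) xt(1), where F = "\<lambda>r. m * \<Phi> r t"
          and ?F1.0 = "\<lambda>r. m * \<Phi>1 r"])
      (use d1 d2 wle space weq in \<open>auto intro: DERIV_cmult\<close>)
  moreover have "(time_deriv u1 x t - time_deriv u2 x t) \<bullet> e - m * \<Phi>3 = 0"
  proof (rule DERIV_local_max[of "\<lambda>s. ?w x s \<bullet> e - m * \<Phi> ((norm x)\<^sup>2) s" _ t, OF _ d(1)])
    show "((\<lambda>s. ?w x s \<bullet> e - m * \<Phi> ((norm x)\<^sup>2) s) has_real_derivative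
        (time_deriv u1 x t - time_deriv u2 x t) \<bullet> e - m * \<Phi>3) (at t)"
      by (intro DERIV_diff DERIV_cmult d3)
        (unfold has_real_derivative_iff_has_vector_derivative,
          intro bounded_linear.has_vector_derivative[OF bounded_linear_inner_left]
            has_vector_derivative_diff time_deriv_works[OF u(1) xt(2)] time_deriv_works[OF u(2) xt(2)])
    show "\<forall>s. \<bar>t - s\<bar> < d \<longrightarrow> ?w x s \<bullet> e - m * \<Phi> ((norm x)\<^sup>2) s \<le> ?w x t \<bullet> e - m * \<Phi> ((norm x)\<^sup>2) t"
      using wle time weq by simp
  qed
  ultimately have "m * (\<Phi>3 - 4 * (norm x)\<^sup>2 * \<Phi>2 - 2 * real CARD('n) * \<Phi>1 ((norm x)\<^sup>2))
      \<le> ((time_deriv u1 x t - time_deriv u2 x t) -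
        (laplacian (\<lambda>y. u1 (y, t)) x - laplacian (\<lambda>y. u2 (y, t)) x)) \<bullet> e"
    unfolding lap by (simp add: inner_diff_left algebra_simps)
  moreover have "W * (((time_deriv u1 x t - time_deriv u2 x t) -
        (laplacian (\<lambda>y. u1 (y, t)) x - laplacian (\<lambda>y. u2 (y, t)) x)) \<bullet> e)
      \<le> W * (K / (norm x)\<^sup>2 * W)"
    using ineq unfolding we W_def[symmetric] by (simp add: power2_eq_square mult_ac)
  then have "((time_deriv u1 x t - time_deriv u2 x t) -
        (laplacian (\<lambda>y. u1 (y, t)) x - laplacian (\<lambda>y. u2 (y, t)) x)) \<bullet> e
      \<le> K / (norm x)\<^sup>2 * W"
    using W by (simp only: mult_le_cancel_left_pos)
  moreover have "K / (norm x)\<^sup>2 * W = m * (K / (norm x)\<^sup>2 * \<Phi> ((norm x)\<^sup>2) t)"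
    using eq by (simp add: W_def)
  moreover have "m * (K / (norm x)\<^sup>2 * \<Phi> ((norm x)\<^sup>2) t)
      < m * (\<Phi>3 - 4 * (norm x)\<^sup>2 * \<Phi>2 - 2 * real CARD('n) * \<Phi>1 ((norm x)\<^sup>2))"
    using strict m(1) by (rule mult_strict_left_mono)
  ultimately show False by linarith
qed

lemma difference_small_initially:
  fixes u1 u2 :: "(real^'n) \<times> real \<Rightarrow> real^'m"
  assumes u: "harmonic_map_flow N u1" "harmonic_map_flow N u2"
    and u0: "comes_out_of u1 u0" "comes_out_of u2 u0"
    and c: "scaled_gradient_bound u1 c" "scaled_gradient_bound u2 c" "0 \<le> c"
    and \<rho>: "0 < \<rho>" and \<eta>: "0 < \<eta>"
  obtains T where "0 < T" "\<And>x t. \<lbrakk>0 < t; t < T; \<rho> \<le> norm x; norm x \<le> R\<rbrakk> \<Longrightarrow> norm (u1 (x, t) - u2 (x, t)) < \<eta>"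
proof -
  define Lc where "Lc = real CARD('n) * (2 * sqrt c / \<rho>)"
  have Lc: "0 \<le> Lc" using c \<rho> by (simp add: Lc_def)
  define d where "d = min (\<rho> / 2) (\<eta> / (4 * (Lc + 1)))"
  have d: "0 < d" "d \<le> \<rho> / 2" unfolding d_def using \<rho> \<eta> Lc by (simp, intro min.cobounded1)
  have "d \<le> \<eta> / (4 * (Lc + 1))" by (simp add: d_def)
  then have "4 * (Lc + 1) * d \<le> \<eta>" using Lc by (simp add: field_simps)
  then have Ld: "2 * (Lc * d) \<le> \<eta> / 2" using d(1) by (simp add: algebra_simps)
  let ?S = "cball 0 R - ball 0 \<rho> :: (real^'n) set"
  have "compact ?S" by (intro compact_diff) auto
  moreover have "?S \<subseteq> (\<Union>y\<in>?S. ball y d)" using d(1) by force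
  ultimately obtain F where F: "F \<subseteq> ?S" "finite F" "?S \<subseteq> (\<Union>y\<in>F. ball y d)"
    using compactE_image[of ?S ?S "\<lambda>y. ball y d"] by auto
  have "\<forall>\<^sub>F t in at_right 0. \<forall>y\<in>F. norm (u1 (y, t) - u2 (y, t)) < \<eta> / 2"
  proof (rule eventually_ball_finite[OF F(2)], rule ballI)
    fix y assume "y \<in> F"
    then have "y \<noteq> 0" using F(1) \<rho> by auto
    then have "((\<lambda>t. u1 (y, t) - u2 (y, t)) \<longlongrightarrow> u0 y - u0 y) (at_right 0)"
      using u0 unfolding comes_out_of_def by (intro tendsto_diff) auto
    then have "((\<lambda>t. u1 (y, t) - u2 (y, t)) \<longlongrightarrow> 0) (at_right 0)" by simp
    then show "\<forall>\<^sub>F t in at_right 0. norm (u1 (y, t) - u2 (y, t)) < \<eta> / 2"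
      using \<eta> by (auto dest!: tendstoD[where e = "\<eta> / 2"])
  qed
  then obtain T where T: "0 < T" "\<And>t y. 0 < t \<Longrightarrow> t < T \<Longrightarrow> y \<in> F \<Longrightarrow> norm (u1 (y, t) - u2 (y, t)) < \<eta> / 2"
    unfolding eventually_at_right_field by auto
  show thesis
  proof (rule that[OF T(1)])
    fix x :: "real^'n" and t assume t: "0 < t" "t < T" and x: "\<rho> \<le> norm x" "norm x \<le> R"
    then have "x \<in> ?S" by auto
    then obtain y where y: "y \<in> F" "dist y x < d" using F(3) by auto
    have ny: "\<rho> \<le> norm y" using y(1) F(1) by auto
    have lip: "norm (v (x, t) - v (y, t)) \<le> Lc * d" if "harmonic_map_flow N v" "scaled_gradient_bound v c" for v
    proof -
      have "norm (v (x, t) - v (y, t)) \<le> Lc * norm (x - y)"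
        unfolding Lc_def using space_lipschitz[OF that t(1) \<rho> ny] y d by (simp add: dist_norm norm_minus_commute)
      also have "\<dots> \<le> Lc * d" using Lc y by (intro mult_left_mono) (auto simp: dist_norm norm_minus_commute)
      finally show ?thesis .
    qed
    have "u1 (x, t) - u2 (x, t) = (u1 (y, t) - u2 (y, t)) + (u1 (x, t) - u1 (y, t)) - (u2 (x, t) - u2 (y, t))"
      by simp
    then have "norm (u1 (x, t) - u2 (x, t))
        \<le> norm (u1 (y, t) - u2 (y, t)) + norm (u1 (x, t) - u1 (y, t)) + norm (u2 (x, t) - u2 (y, t))"
      using norm_triangle_ineq[of "u1 (y, t) - u2 (y, t)" "u1 (x, t) - u1 (y, t)"]
        norm_triangle_ineq4[of "u1 (y, t) - u2 (y, t) + (u1 (x, t) - u1 (y, t))" "u2 (x, t) - u2 (y, t)"]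
      by simp
    then show "norm (u1 (x, t) - u2 (x, t)) < \<eta>"
      using T(2)[OF t y(1)] lip[OF u(1) c(1)] lip[OF u(2) c(2)] Ld by linarith
  qed
qed

lemma Omega_iff: "(x, t) \<in> Omega l \<longleftrightarrow> 0 < t \<and> 4 * l * t < (norm x)\<^sup>2"
  by (auto simp: Omega_def field_simps)

lemma open_Omega: "open (Omega l)"
proof -
  have "Omega l = {z. 0 < snd z} \<inter> {z. 4 * l * snd z < (norm (fst z))\<^sup>2}"
    by (auto simp: Omega_iff)
  also have "open \<dots>"
    by (intro open_Int open_Collect_less continuous_intros)
  finally show ?thesis .
qed

lemma continuous_on_barrier:
  assumes "\<And>z. z \<in> S \<Longrightarrow> 0 < norm (fst z) \<and> 0 < snd z"
  shows "continuous_on S (\<lambda>z. barrier b a A M \<epsilon> ((norm (fst z))\<^sup>2) (snd z))"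
  unfolding barrier_def profile_def using assms by (intro continuous_intros) fastforce+

lemma difference_le_barrier:
  fixes u1 u2 :: "(real^'n) \<times> real \<Rightarrow> real^'m"
  assumes N: "submanifold d N" and C0: "0 < C"
    and C: "\<And>p q \<nu>. p \<in> N \<Longrightarrow> q \<in> N \<Longrightarrow> \<nu> \<in> (tangent_space N p)\<^sup>\<bottom>
      \<Longrightarrow> \<bar>(q - p) \<bullet> \<nu>\<bar> \<le> C * norm \<nu> * (norm (q - p))\<^sup>2"
    and D: "0 < D" "\<And>p q. p \<in> N \<Longrightarrow> q \<in> N \<Longrightarrow> norm (p - q) \<le> D"
    and u: "harmonic_map_flow N u1" "harmonic_map_flow N u2"
    and u0: "comes_out_of u1 u0" "comes_out_of u2 u0"
    and c: "scaled_gradient_bound u1 c" "scaled_gradient_bound u2 c" "0 \<le> c"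
    and K: "K = 4 * C\<^sup>2 * c" and n: "n = real CARD('n)" and a: "a = n / 2 + K / 4"
    and l: "24 + K \<le> l" "a \<le> l"
    and A: "0 \<le> A" "D \<le> A * profile (n / 2) a l"
    and M: "M = 4 * (n + K + 8)" and \<epsilon>: "0 < \<epsilon>"
    and xt: "(x, t) \<in> Omega l"
  shows "norm (u1 (x, t) - u2 (x, t)) \<le> barrier (n / 2) a A M \<epsilon> ((norm x)\<^sup>2) t"
proof (rule ccontr)
  let ?w = "\<lambda>z. norm (u1 z - u2 z)"
  let ?H = "\<lambda>z. barrier (n / 2) a A M \<epsilon> ((norm (fst z))\<^sup>2) (snd z)"
  assume "\<not> ?thesis"
  then have gt: "?H (x, t) < ?w (x, t)" by simp
  have n0: "0 \<le> n" and K0: "0 \<le> K" using n K c(3) by auto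
  have l0: "0 < l" and M0: "0 \<le> M" using n0 K0 l(1) M by auto
  have wD: "?w (y, s) \<le> D" if "0 < s" for y s
    using D(2) harmonic_map_flow_in[OF u(1) that] harmonic_map_flow_in[OF u(2) that] by blast
  define R where "R = D / \<epsilon>"
  define \<rho> where "\<rho> = \<epsilon> / D"
  have R: "0 < R" and \<rho>: "0 < \<rho>" using D(1) \<epsilon> by (auto simp: R_def \<rho>_def)
  obtain T where T: "0 < T" "\<And>y s. \<lbrakk>0 < s; s < T; sqrt \<rho> \<le> norm y; norm y \<le> sqrt R\<rbrakk> \<Longrightarrow> ?w (y, s) < \<epsilon> * \<rho>"
    using difference_small_initially[OF u u0 c, of "sqrt \<rho>" "\<epsilon> * \<rho>" "sqrt R"] \<rho> \<epsilon> by auto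
  define Q where "Q = (cball 0 (sqrt R) \<times> {T..R / (4 * l)}) \<inter> {z. \<rho> \<le> (norm (fst z))\<^sup>2}
      \<inter> {z::(real^'n) \<times> real. 4 * l * snd z \<le> (norm (fst z))\<^sup>2}"
  have "compact Q" unfolding Q_def
    by (intro compact_Int_closed compact_Times compact_cball compact_Icc closed_Collect_le continuous_intros)
  have Qpos: "0 < norm (fst z)" "0 < snd z" if "z \<in> Q" for z
    using that \<rho> T(1) by (auto simp: Q_def)
  have Hge: "\<epsilon> / (norm y)\<^sup>2 \<le> ?H (y, s)" "\<epsilon> * (norm y)\<^sup>2 \<le> ?H (y, s)"
    if "0 < s" "4 * l * s \<le> (norm y)\<^sup>2" for y s
  proof -
    have "0 < 4 * l * s" using l0 that by simp
    then have "0 < (norm y)\<^sup>2" using that by linarith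
    moreover have "l \<le> (norm y)\<^sup>2 / (4 * s)" using that by (simp add: field_simps)
    ultimately show "\<epsilon> / (norm y)\<^sup>2 \<le> ?H (y, s)" "\<epsilon> * (norm y)\<^sup>2 \<le> ?H (y, s)"
      using that(1) \<epsilon> M0 A(1) l(2) barrier_ge_error[of "(norm y)\<^sup>2" s \<epsilon> M A a "n / 2"] by auto
  qed
  have Hpos: "0 < ?H (y, s)" if "0 < s" "4 * l * s \<le> (norm y)\<^sup>2" for y s
  proof -
    have "0 < 4 * l * s" using l0 that by simp
    then have "0 < \<epsilon> * (norm y)\<^sup>2" using that \<epsilon> by (intro mult_pos_pos) auto
    then show ?thesis using Hge(2)[OF that] by linarith
  qed
  have in_Q: "(y, s) \<in> Q" if ys: "(y, s) \<in> Omega l" and ge: "?H (y, s) \<le> ?w (y, s)" for y s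
  proof -
    have s: "0 < s" "4 * l * s \<le> (norm y)\<^sup>2" using ys by (auto simp: Omega_iff)
    have "0 < 4 * l * s" using l0 s by simp
    then have y2: "0 < (norm y)\<^sup>2" using s by linarith
    have "\<epsilon> * (norm y)\<^sup>2 \<le> D" "\<epsilon> / (norm y)\<^sup>2 \<le> D"
      using Hge[OF s] ge wD[OF s(1), of y] by linarith+
    then have yR: "(norm y)\<^sup>2 \<le> R" and y\<rho>: "\<rho> \<le> (norm y)\<^sup>2"
      using \<epsilon> D(1) y2 by (auto simp: R_def \<rho>_def field_simps)
    then have "norm y \<le> sqrt R" "sqrt \<rho> \<le> norm y"
      using R by (auto intro: real_le_rsqrt real_le_lsqrt)
    moreover have "\<epsilon> * \<rho> \<le> ?w (y, s)"
      using mult_left_mono[OF y\<rho>, of \<epsilon>] \<epsilon> Hge(2)[OF s] ge by linarith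
    ultimately have "T \<le> s" using T(2)[OF s(1), of y] by (meson not_le)
    moreover have "s \<le> R / (4 * l)" using s yR l0 by (simp add: field_simps)
    ultimately show ?thesis
      using \<open>norm y \<le> sqrt R\<close> y\<rho> s by (auto simp: Q_def)
  qed
  have contw: "continuous_on Q ?w"
  proof -
    have "continuous_on (UNIV \<times> {0<..}) u1" "continuous_on (UNIV \<times> {0<..}) u2"
      using u by (auto simp: harmonic_map_flow_def smooth_on_def dest: spec[of _ 0])
    moreover have "Q \<subseteq> UNIV \<times> {0<..}" using Qpos by force
    ultimately show ?thesis by (intro continuous_intros) (auto intro: continuous_on_subset)
  qed
  have HposQ: "0 < ?H z" if "z \<in> Q" for z
    using that Hpos[of "snd z" "fst z"] T(1) by (auto simp: Q_def)
  have "continuous_on Q (\<lambda>z. ?w z / ?H z)"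
    using HposQ Qpos by (intro continuous_on_divide contw continuous_on_barrier) force+
  moreover have xtQ: "(x, t) \<in> Q" using in_Q[OF xt] gt by simp
  ultimately obtain z where z: "z \<in> Q" "\<And>z'. z' \<in> Q \<Longrightarrow> ?w z' / ?H z' \<le> ?w z / ?H z"
    using continuous_attains_sup[OF \<open>compact Q\<close>, of "\<lambda>z. ?w z / ?H z"] by blast
  obtain y s where ys: "z = (y, s)" by (cases z)
  define m where "m = ?w z / ?H z"
  have "1 < ?w (x, t) / ?H (x, t)" using gt HposQ[OF xtQ] by simp
  then have m: "1 < m" using z(2)[OF xtQ] by (simp add: m_def)
  have eq: "?w (y, s) = m * ?H (y, s)" using HposQ[OF z(1)] by (simp add: m_def ys)
  have s: "0 < s" "4 * l * s \<le> (norm y)\<^sup>2" using z(1) T(1) by (auto simp: Q_def ys)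
  have Hz: "0 < ?H (y, s)" by (rule Hpos[OF s])
  have Hw: "?H (y, s) < ?w (y, s)" using eq m Hz by simp
  have "4 * l * s \<noteq> (norm y)\<^sup>2"
  proof
    assume e: "4 * l * s = (norm y)\<^sup>2"
    then have "(norm y)\<^sup>2 / (4 * s) = l" using s(1) by (simp add: field_simps)
    moreover have "0 < (norm y)\<^sup>2" unfolding e[symmetric] using l0 s by simp
    ultimately have "D \<le> ?H (y, s)"
      using barrier_ge_profile[of "(norm y)\<^sup>2" s \<epsilon> M A "n / 2" a] A(2) s(1) \<epsilon> M0 by simp
    then show False using Hw wD[OF s(1), of y] by linarith
  qed
  then have ysO: "(y, s) \<in> Omega l" using s by (simp add: Omega_iff)
  have le: "?w z' \<le> m * ?H z'" if "z' \<in> Omega l" for z'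
  proof (cases "?H z' \<le> ?w z'")
    case True
    then have "z' \<in> Q" using in_Q[of "fst z'" "snd z'"] that by simp
    then show ?thesis using z(2)[of z'] HposQ[of z'] by (simp add: m_def field_simps)
  next
    case False
    have "0 < ?H z'" using that Hpos[of "snd z'" "fst z'"] Omega_iff[of "fst z'" "snd z'" l] by simp
    from mult_strict_right_mono[OF m this] show ?thesis using False by linarith
  qed
  have y0: "y \<noteq> 0" using Qpos(1)[OF z(1)] by (auto simp: ys)
  then have y2: "0 < (norm y)\<^sup>2" by simp
  have s': "4 * (24 + K) * s \<le> (norm y)\<^sup>2"
    using s mult_right_mono[OF l(1), of "4 * s"] by (simp add: algebra_simps)
  show False
  proof (rule no_interior_touching[OF u open_Omega ysO, where \<Phi> = "barrier (n / 2) a A M \<epsilon>"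
        and ?\<Phi>1.0 = "\<lambda>r. barrier_r (n / 2) a A M \<epsilon> r s" and m = m and K = K])
    show "Omega l \<subseteq> {(x :: real^'n, t). x \<noteq> 0 \<and> 0 < t}"
    proof clarify
      fix y :: "real^'n" and s assume "(y, s) \<in> Omega l"
      then have "0 < s" "4 * l * s < (norm y)\<^sup>2" by (auto simp: Omega_iff)
      moreover from this have "0 < 4 * l * s" using l0 by simp
      ultimately show "y \<noteq> 0 \<and> 0 < s" by auto
    qed
    show "((time_deriv u1 y s - time_deriv u2 y s) -
        (laplacian (\<lambda>x. u1 (x, s)) y - laplacian (\<lambda>x. u2 (x, s)) y)) \<bullet> (u1 (y, s) - u2 (y, s))
      \<le> K / (norm y)\<^sup>2 * (norm (u1 (y, s) - u2 (y, s)))\<^sup>2"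
      unfolding K by (rule heat_inequality[OF N u s(1) y0 C0 C c(1,2)])
    show "K / (norm y)\<^sup>2 * barrier (n / 2) a A M \<epsilon> ((norm y)\<^sup>2) s
        < barrier_t (n / 2) a A M \<epsilon> ((norm y)\<^sup>2) s
          - 4 * (norm y)\<^sup>2 * barrier_rr (n / 2) a A M \<epsilon> ((norm y)\<^sup>2) s
          - 2 * real CARD('n) * barrier_r (n / 2) a A M \<epsilon> ((norm y)\<^sup>2) s"
      using barrier_strict_supersolution[OF y2 s(1) s' n0 K0 _ A(1) \<epsilon> M, of a] a n by simp
    show "norm (u1 (y', s') - u2 (y', s')) \<le> m * barrier (n / 2) a A M \<epsilon> ((norm y')\<^sup>2) s'"
      if "(y', s') \<in> Omega l" for y' s'
      using le[OF that] by simp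
    show "norm (u1 (y, s) - u2 (y, s)) = m * barrier (n / 2) a A M \<epsilon> ((norm y)\<^sup>2) s"
      using eq by simp
    show "0 < barrier (n / 2) a A M \<epsilon> ((norm y)\<^sup>2) s" using Hz by simp
  qed (use m s(1) y2 in \<open>auto intro: barrier_has_derivative_r barrier_has_derivative_rr barrier_has_derivative_t\<close>)
qed

lemma profile_le_weight:
  assumes "0 < b" "0 \<le> a" "b \<le> s"
  shows "profile b a s \<le> 2 powr b * exp b * ((s + b) powr (-b) * exp (- (s + b)))"
proof -
  have s: "0 < s" using assms by simp
  have "profile b a s \<le> s powr (-b) * exp (-s) * 1"
    unfolding profile_def using assms s by (intro mult_left_mono) auto
  also have "s powr (-b) = 2 powr b * (2 * s) powr (-b)"
    using s by (simp add: powr_mult powr_minus)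
  also have "\<dots> \<le> 2 powr b * (s + b) powr (-b)"
    using assms s by (intro mult_left_mono powr_mono2') auto
  also have "exp (-s) = exp b * exp (- (s + b))" by (simp flip: exp_add)
  finally show ?thesis by (simp add: mult_ac)
qed

theorem theorem2p4:
  fixes N :: "(real^'m::finite) set" and c0 :: real
  assumes "3 \<le> CARD('n::finite)"
    and "connected_closed_manifold N"
    and "0 < c0"
  shows "\<exists>lam0>0. \<exists>lam\<ge>lam0. \<exists>C>0.
           \<forall>(u0 :: real^'n \<Rightarrow> real^'m) u1 u2.
             zero_homogeneous N u0 \<and>
             harmonic_map_flow N u1 \<and> comes_out_of u1 u0 \<and>
             harmonic_map_flow N u2 \<and> comes_out_of u2 u0 \<and>
             regular_at_infinity u1 \<and> regular_at_infinity u2 \<and>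
             scaled_gradient_bound u1 c0 \<and> scaled_gradient_bound u2 c0 \<longrightarrow>
             (\<forall>(x, t) \<in> Omega lam.
                norm (u1 (x, t) - u2 (x, t))
                  \<le> C * weight_f (x, t) powr (- real CARD('n) / 2) * exp (- weight_f (x, t)))"
proof -
  obtain d where N: "submanifold d N" "compact N"
    using assms(2) unfolding connected_closed_manifold_def by blast
  obtain C where C: "0 < C" "\<And>p q \<nu>. p \<in> N \<Longrightarrow> q \<in> N \<Longrightarrow> \<nu> \<in> (tangent_space N p)\<^sup>\<bottom>
      \<Longrightarrow> \<bar>(q - p) \<bullet> \<nu>\<bar> \<le> C * norm \<nu> * (norm (q - p))\<^sup>2"
    using compact_submanifold_normal_quadratic[OF N] by metis
  obtain B where B: "0 < B" "\<And>p. p \<in> N \<Longrightarrow> norm p \<le> B"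
    using compact_imp_bounded[OF N(2)] unfolding bounded_pos by blast
  define D where "D = 2 * B"
  have D0: "0 < D" using B by (simp add: D_def)
  have D: "norm (p - q) \<le> D" if "p \<in> N" "q \<in> N" for p q
    using B(2)[OF that(1)] B(2)[OF that(2)] norm_triangle_ineq4[of p q] by (simp add: D_def)
  define n where "n = real CARD('n)"
  define K where "K = 4 * C\<^sup>2 * c0"
  define a where "a = n / 2 + K / 4"
  define l where "l = 2 * a + 24 + K"
  define E where "E = l powr (- (n / 2)) * exp (-l)"
  define A where "A = 2 * D / E"
  define C' where "C' = A * (2 powr (n / 2) * exp (n / 2))"
  have n: "0 < n" by (simp add: n_def)
  have K: "0 \<le> K" using assms(3) by (simp add: K_def)
  have a: "0 < a" using n K by (simp add: a_def)
  have l: "0 < l" "24 + K \<le> l" "2 * a \<le> l" using a K by (auto simp: l_def)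
  have E: "0 < E" using l by (simp add: E_def)
  have A: "0 < A" using D0 E by (simp add: A_def)
  have "1 / 2 \<le> 1 - a / l" using l by (simp add: field_simps)
  then have "A * (E * (1 / 2)) \<le> A * (E * (1 - a / l))" using A E by (intro mult_left_mono) auto
  then have AD: "D \<le> A * profile (n / 2) a l"
    using E by (simp add: A_def profile_def E_def[symmetric])
  show ?thesis
  proof (rule exI[of _ l], rule conjI[OF l(1)], rule exI[of _ l], rule conjI[OF order_refl],
      rule exI[of _ C'], intro conjI allI impI)
    show "0 < C'" using A by (simp add: C'_def)
    fix u0 :: "real^'n \<Rightarrow> real^'m" and u1 u2
    assume "zero_homogeneous N u0 \<and>
      harmonic_map_flow N u1 \<and> comes_out_of u1 u0 \<and>
      harmonic_map_flow N u2 \<and> comes_out_of u2 u0 \<and>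
      regular_at_infinity u1 \<and> regular_at_infinity u2 \<and>
      scaled_gradient_bound u1 c0 \<and> scaled_gradient_bound u2 c0"
    then have u: "harmonic_map_flow N u1" "harmonic_map_flow N u2"
      "comes_out_of u1 u0" "comes_out_of u2 u0"
      "scaled_gradient_bound u1 c0" "scaled_gradient_bound u2 c0" by auto
    show "\<forall>(x, t) \<in> Omega l. norm (u1 (x, t) - u2 (x, t))
        \<le> C' * weight_f (x, t) powr (- real CARD('n) / 2) * exp (- weight_f (x, t))"
    proof clarify
      fix x :: "real^'n" and t :: real
      assume xt: "(x, t) \<in> Omega l"
      define r where "r = (norm x)\<^sup>2"
      define M where "M = 4 * (n + K + 8)"
      define h where "h = 1 / r + M * t / r\<^sup>2 + r + M * t"
      have t: "0 < t" "4 * l * t < r" using xt by (auto simp: Omega_iff r_def)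
      moreover have "0 < 4 * l * t" using t l by simp
      ultimately have r: "0 < r" by linarith
      have M: "0 < M" using n K by (simp add: M_def)
      have h: "0 < h" using r t M by (simp add: h_def add_pos_pos)
      have "norm (u1 (x, t) - u2 (x, t)) \<le> A * profile (n / 2) a (r / (4 * t))"
      proof (rule field_le_epsilon)
        fix \<epsilon> :: real assume "0 < \<epsilon>"
        then have "0 < \<epsilon> / h" using h by simp
        from difference_le_barrier[OF N(1) C D0 D u(1-4) u(5,6) _ K_def n_def a_def l(2) _ _ AD M_def this xt]
        have "norm (u1 (x, t) - u2 (x, t)) \<le> barrier (n / 2) a A M (\<epsilon> / h) r t"
          using assms(3) l a A by (simp add: r_def)
        also have "\<dots> = A * profile (n / 2) a (r / (4 * t)) + \<epsilon>"
          using h by (simp add: barrier_def h_def[symmetric])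
        finally show "norm (u1 (x, t) - u2 (x, t)) \<le> A * profile (n / 2) a (r / (4 * t)) + \<epsilon>" .
      qed
      also have "\<dots> \<le> A * (2 powr (n / 2) * exp (n / 2) *
          ((r / (4 * t) + n / 2) powr (- (n / 2)) * exp (- (r / (4 * t) + n / 2))))"
      proof (intro mult_left_mono profile_le_weight)
        have "n / 2 \<le> l" using l a K by (simp add: a_def)
        also have "l \<le> r / (4 * t)" using t by (simp add: field_simps)
        finally show "n / 2 \<le> r / (4 * t)" .
      qed (use n a A in auto)
      also have "\<dots> = C' * weight_f (x, t) powr (- real CARD('n) / 2) * exp (- weight_f (x, t))"
        by (simp add: C'_def weight_f_def r_def n_def mult_ac)
      finally show "norm (u1 (x, t) - u2 (x, t))
        \<le> C' * weight_f (x, t) powr (- real CARD('n) / 2) * exp (- weight_f (x, t))" .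
    qed
  qed
qed

end
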